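(* Let $a\in\mathbb{R}$. For all $t\in[0,1)$, $x\in\mathbb{R}$ and $\pi\in[0,1]$, the value function $$V(t,x,\pi)=\sup_{0\le\tau\le 1-t}\mathbb{E}_\pi\bigl[X^{t,x}_{t+\tau}\bigr]$$ satisfies $$V(t,x,\pi)\le\bigl(1-\Pi(t,x,\pi)\bigr)\bigl(x+\max(a,0)\bigr)+\Pi(t,x,\pi)\,V_1^a(t,x).$$
   Context: Setting. The process $X$ is either a Brownian motion with known drift $a$ ($\theta=0$) or a Brownian bridge pinning to $a$ at time $1$ ($\theta=1$), and $\theta$ is not observed. Learning starts at time $0$ with $X_0=0$ and prior belief $\pi\in[0,1]$ that $\theta=1$. If the process is at $x$ at time $t\in[0,1)$, the updated belief that $\theta=1$ is $$\Pi(t,x,\pi):=\frac{\frac{\pi}{1-\pi}L^a(t,x)}{1+\frac{\pi}{1-\pi}L^a(t,x)}=\frac{\pi L^a(t,x)}{1-\pi+\pi L^a(t,x)},\qquad L^a(t,x):=\frac{1}{\sqrt{1-t}}\exp\Bigl(-\frac{(x-at)^2}{2(1-t)}\Bigr)$$ (the last expression for $\Pi$ is used for $\pi=1$, giving $\Pi(t,x,1)=1$). Embedded problem. Given $(t,x,\pi)$, under $\mathbb{P}_\pi$ the process $X=X^{t,x}$ starts at $X_t=x$, the hidden variable $\theta$ takes the value $1$ with probability $\Pi(t,x,\pi)$ and $0$ with probability $1-\Pi(t,x,\pi)$, and $$dX_{t+s}=\Bigl[(1-\theta)a+\theta\,\frac{a-X_{t+s}}{1-t-s}\Bigr]ds+dB_{t+s},\qquad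 0\le s<1-t,$$ where $B$ is a standard Brownian motion independent of $\theta$; $X_1$ is the limit of $X_{t+s}$ as $s\uparrow 1-t$. (Equivalently, in the observation filtration, $dX_{t+s}=(a+\Pi_{t+s}\rho(t+s,X_{t+s}))\,ds+d\bar B_{t+s}$ and $d\Pi_{t+s}=\rho(t+s,X_{t+s})\Pi_{t+s}(1-\Pi_{t+s})\,d\bar B_{t+s}$ with $\Pi_t=\Pi(t,x,\pi)$, $\rho(u,y)=\frac{a-y}{1-u}-a$, and $\bar B$ the innovation Brownian motion.) The supremum defining $V$ is over stopping times $\tau$ of the observed process $(X_{t+s})_{s\ge0}$ with $0\le\tau\le1-t$. Known-pinning value function. Let $\pi_\circ=3.14159\ldots$ be the circle constant, $\Phi$ the standard normal distribution function, $\alpha\approx 0.839924$ the unique positive solution of $\sqrt{2\pi_\circ}(1-\alpha^2)e^{\alpha^2/2}\Phi(\alpha)=\alpha$, and $b(t):=a+\alpha\sqrt{1-t}$. For $t<1$, $$V_1^a(t,x):=\begin{cases}a+\sqrt{2\pi_\circ(1-t)}\,(1-\alpha^2)\exp\bigl(\frac{(x-a)^2}{2(1-t)}\bigr)\Phi\bigl(\frac{x-a}{\sqrt{1-t}}\bigr), & x<b(t),\\ x, & x\ge b(t).\end{cases}$$ *)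

theory Defs
  imports "HOL-Probability.Probability"
begin

definition likelihood :: "real \<Rightarrow> real \<Rightarrow> real \<Rightarrow> real" where
  "likelihood a t x = 1 / sqrt (1 - t) * exp (- ((x - a * t)\<^sup>2 / (2 * (1 - t))))"

definition belief :: "real \<Rightarrow> real \<Rightarrow> real \<Rightarrow> real \<Rightarrow> real" where
  "belief a t x p = p * likelihood a t x / (1 - p + p * likelihood a t x)"

definition std_normal_cdf :: "real \<Rightarrow> real" where
  "std_normal_cdf = cdf std_normal_distribution"

definition boundary_const :: real where
  "boundary_const = (THE \<alpha>. 0 < \<alpha> \<and>
     sqrt (2 * pi) * (1 - \<alpha>\<^sup>2) * exp (\<alpha>\<^sup>2 / 2) * std_normal_cdf \<alpha> = \<alpha>)"

definition boundary :: "real \<Rightarrow> real \<Rightarrow> real" where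
  "boundary a t = a + boundary_const * sqrt (1 - t)"

definition pinned_value :: "real \<Rightarrow> real \<Rightarrow> real \<Rightarrow> real" where
  "pinned_value a t x =
     (if x < boundary a t
      then a + sqrt (2 * pi * (1 - t)) * (1 - boundary_const\<^sup>2) *
             exp ((x - a)\<^sup>2 / (2 * (1 - t))) * std_normal_cdf ((x - a) / sqrt (1 - t))
      else x)"

definition generated ::
    "'a measure \<Rightarrow> (real \<Rightarrow> 'a \<Rightarrow> real) \<Rightarrow> real set \<Rightarrow> 'a measure" where
  "generated M Y I = sigma (space M) {Y r -` A \<inter> space M | r A. r \<in> I \<and> A \<in> sets borel}"

text \<open>Standard Brownian motion on \<open>[0, \<infinity>)\<close> with respect to its own filtration; only the values
  \<open>B u\<close> with \<open>u \<ge> 0\<close> matter.\<close>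

definition (in prob_space) standard_brownian_motion :: "(real \<Rightarrow> 'a \<Rightarrow> real) \<Rightarrow> bool" where
  "standard_brownian_motion B \<longleftrightarrow>
     (\<forall>u\<ge>0. random_variable borel (B u)) \<and>
     (AE \<omega> in M. B 0 \<omega> = 0) \<and>
     (AE \<omega> in M. continuous_on {0..} (\<lambda>u. B u \<omega>)) \<and>
     (\<forall>u v. 0 \<le> u \<longrightarrow> u < v \<longrightarrow>
        distributed M lborel (\<lambda>\<omega>. B v \<omega> - B u \<omega>) (normal_density 0 (sqrt (v - u))) \<and>
        indep_set (sets (generated M B {0..u}))
                  (sets (vimage_algebra (space M) (\<lambda>\<omega>. B v \<omega> - B u \<omega>) borel)))"

text \<open>A realisation of the embedded problem started at \<open>(t, x)\<close> with prior belief \<open>p\<close> at time \<open>0\<close>.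
  Both \<open>X\<close> and \<open>B\<close> are indexed by calendar time. As the noise is additive, the stochastic
  differential equation is the pathwise integral equation \<open>sde\<close>, which at \<open>s = 0\<close> contains the
  initial condition \<open>X t = x\<close>. Continuity on the closed interval makes \<open>X 1\<close> the limit of \<open>X u\<close> as
  \<open>u\<close> increases to \<open>1\<close>. It is required of every path, not just of almost every one, so that \<open>X\<close>
  evaluated at a random time is measurable without completing \<open>M\<close>.\<close>

locale embedded_problem = prob_space M
  for M :: "'a measure" and a t x p :: real
    and \<theta> :: "'a \<Rightarrow> real" and B X :: "real \<Rightarrow> 'a \<Rightarrow> real" +
  assumes rv_\<theta>: "random_variable borel \<theta>"
    and prob_\<theta>_1: "prob {\<omega> \<in> space M. \<theta> \<omega> = 1} = belief a t x p"
    and prob_\<theta>_0: "prob {\<omega> \<in> space M. \<theta> \<omega> = 0} = 1 - belief a t x p"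
    and brownian: "standard_brownian_motion B"
    and indep: "indep_set (sets (vimage_algebra (space M) \<theta> borel)) (sets (generated M B {0..}))"
    and rv_X: "\<And>u. u \<in> {t..1} \<Longrightarrow> random_variable borel (X u)"
    and continuous_X: "\<And>\<omega>. \<omega> \<in> space M \<Longrightarrow> continuous_on {t..1} (\<lambda>u. X u \<omega>)"
    and sde: "AE \<omega> in M. \<forall>s. 0 \<le> s \<and> s < 1 - t \<longrightarrow>
        X (t + s) \<omega> =
          x + integral {0..s} (\<lambda>r. (1 - \<theta> \<omega>) * a + \<theta> \<omega> * ((a - X (t + r) \<omega>) / (1 - t - r)))
            + (B (t + s) \<omega> - B t \<omega>)"

text \<open>The filtration generated by the observed process, indexed by the time elapsed since \<open>t\<close>;
  it is trivial for negative \<open>s\<close>.\<close>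

definition observation_filtration ::
    "'a measure \<Rightarrow> real \<Rightarrow> (real \<Rightarrow> 'a \<Rightarrow> real) \<Rightarrow> real \<Rightarrow> 'a measure" where
  "observation_filtration M t X s = generated M (\<lambda>r. X (t + r)) {0..s}"

definition admissible_times ::
    "'a measure \<Rightarrow> real \<Rightarrow> (real \<Rightarrow> 'a \<Rightarrow> real) \<Rightarrow> ('a \<Rightarrow> real) set" where
  "admissible_times M t X =
     {\<tau>. stopping_time (observation_filtration M t X) \<tau> \<and>
         (\<forall>\<omega>\<in>space M. 0 \<le> \<tau> \<omega> \<and> \<tau> \<omega> \<le> 1 - t)}"

text \<open>The supremum is taken in the extended reals, so that no boundedness is presupposed.\<close>

definition stopping_value :: "'a measure \<Rightarrow> real \<Rightarrow> (real \<Rightarrow> 'a \<Rightarrow> real) \<Rightarrow> ereal" where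
  "stopping_value M t X =
     (SUP \<tau>\<in>admissible_times M t X. ereal (\<integral>\<omega>. X (t + \<tau> \<omega>) \<omega> \<partial>M))"

end

theory Submission
  imports Defs
begin

text \<open>Split the reward according to \<open>\<theta>\<close>. On \<open>{\<theta> = 0}\<close> the path is \<open>x + a s\<close> plus the stopped noise,
  which has mean at most \<open>0\<close>. On \<open>{\<theta> = 1}\<close> the process \<open>m = (X - a) / (1 - u)\<close> is a Brownian motion in the
  clock \<open>\<sigma> = 1 / (1 - u)\<close>, so every \<open>exp (l m - l\<^sup>2 \<sigma> / 2)\<close> is a nonnegative supermartingale. Integrated over
  \<open>l \<ge> 0\<close> and multiplied by \<open>1 - \<alpha>\<^sup>2\<close>, these give \<open>V\<^sub>1 - a\<close> below the boundary, and the choice of \<open>\<alpha>\<close> makes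
  the mixture tangent to the reward \<open>X - a\<close> from above, everywhere. Optional stopping for the exponentials
  follows from grid approximations and Fatou's lemma because, up to null sets, the observation carries no
  information beyond the noise on each of the two events.\<close>

section \<open>The tangency of the mixture\<close>

text \<open>The factor 1 - \<alpha>^2 is forced by tangency. Put h z = sqrt (2 pi) exp (z^2 / 2)
  \<Phi>(z), so that h' = z h + 1. The smallest C with C h z \<ge> z everywhere touches where h = z
  h', that is where (1 - z^2) h z = z. This is the equation of \<alpha>, and C = \<alpha> / h
  \<alpha> = 1 - \<alpha>^2. The main obstacle is the filtration: the past of X also carries
  information on \<theta>, so \<tau> is in general no stopping time of B. On each of the two events,
  however, {\<tau> > r} agrees almost surely with an event of the past of B. That event lives on the
  whole space and is independent of \<theta>, so the indicator of the \<theta>-event factors out of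
  the expectation. The bridge drift is singular at time 1, hence \<tau> is cut off before the
  horizon. Removing the cutoff, and giving the expectations their usual meaning, takes an integrable
  majorant of the whole path, which comes from a chaining bound for the Brownian supremum.\<close>

lemma has_real_derivative_std_normal_cdf:
  "(std_normal_cdf has_real_derivative std_normal_density z) (at z)"
proof -
  interpret real_distribution std_normal_distribution
    by (rule real_dist_normal_dist)
  \<comment> \<open>The base point z - 1 makes z an interior point of the window, so that the
    derivative within the window is the full derivative.\<close>
  have cdf_eq: "std_normal_cdf y = std_normal_cdf (z - 1) + integral {z - 1..y} std_normal_density"
    if "y \<in> {z - 1..z + 1}" for y
  proof (cases "y = z - 1")
    case False
    with that have "z - 1 < y" by auto
    then have "std_normal_cdf y - std_normal_cdf (z - 1) = measure std_normal_distribution {z - 1<..y}"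
      unfolding std_normal_cdf_def by (rule cdf_diff_eq)
    also have "\<dots> = (\<integral>u. indicator {z - 1<..y} u \<partial>std_normal_distribution)"
      by simp
    also have "\<dots> = (\<integral>u. std_normal_density u * indicator {z - 1<..y} u \<partial>lborel)"
      by (subst integral_density) (auto simp: mult.commute)
    also have "\<dots> = (LINT u:{z - 1<..y}|lborel. std_normal_density u)"
      by (simp add: set_lebesgue_integral_def mult.commute)
    \<comment> \<open>The half-open and the closed interval differ by the null set {z - 1}; the
      closed one fits the fundamental theorem of calculus.\<close>
    also have "\<dots> = (LINT u:{z - 1..y}|lborel. std_normal_density u)"
      unfolding set_lebesgue_integral_def
      by (rule integral_cong_AE) (use AE_lborel_singleton[of "z - 1"] in \<open>auto elim!: eventually_mono simp: indicator_def\<close>)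
    also have "\<dots> = integral {z - 1..y} std_normal_density"
      by (rule set_borel_integral_eq_integral)
        (auto simp: set_integrable_def intro!: integrable_real_mult_indicator integrable_normal_density
          simp: mult.commute[of "indicator _ _"])
    finally show ?thesis by simp
  qed simp
  have "continuous_on {z - 1..z + 1} std_normal_density"
    unfolding std_normal_density_def by (intro continuous_intros) auto
  then have "((\<lambda>y. integral {z - 1..y} std_normal_density) has_real_derivative std_normal_density z)
      (at z within {z - 1..z + 1})"
    by (rule integral_has_real_derivative) auto
  then have "((\<lambda>y. std_normal_cdf (z - 1) + integral {z - 1..y} std_normal_density)
      has_real_derivative std_normal_density z) (at z within {z - 1..z + 1})"
    by (auto intro!: derivative_eq_intros)
  then have "(std_normal_cdf has_real_derivative std_normal_density z) (at z within {z - 1..z + 1})"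
    by (rule has_field_derivative_transform_within[where d = 1]) (auto simp: cdf_eq[symmetric] dist_real_def)
  moreover have "at z within {z - 1..z + 1} = at z"
    by (rule at_within_interior) (auto simp: interior_atLeastAtMost_real)
  ultimately show ?thesis by simp
qed

lemma std_normal_cdf_nonneg: "0 \<le> std_normal_cdf z"
  by (simp add: std_normal_cdf_def cdf_def)

text \<open>A zero is impossible: strict increase, from the positive density, would make the value
  at z - 1 negative.\<close>

lemma std_normal_cdf_pos: "0 < std_normal_cdf z"
proof -
  have "std_normal_cdf (z - 1) < std_normal_cdf z"
    by (rule DERIV_pos_imp_increasing[of "z - 1" z])
      (auto intro!: exI has_real_derivative_std_normal_cdf normal_density_pos)
  then show ?thesis
    using std_normal_cdf_nonneg[of "z - 1"] by linarith
qed

lemma std_normal_cdf_scaled_derivative: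
  "((\<lambda>z. sqrt (2 * pi) * std_normal_cdf z) has_real_derivative exp (- z\<^sup>2 / 2)) (at z)"
  using DERIV_cmult[OF has_real_derivative_std_normal_cdf, of "sqrt (2 * pi)" z]
  by (simp add: std_normal_density_def)

text \<open>The defining equation of \<open>\<alpha>\<close>, multiplied by \<open>exp (- \<alpha>\<^sup>2 / 2)\<close>, says that \<open>\<alpha>\<close> is a zero of
  a function that is strictly decreasing on \<open>[0, \<infinity>)\<close>.\<close>

lemma boundary_const_props:
  shows boundary_const_pos: "0 < boundary_const"
    and boundary_const_less_1: "boundary_const < 1"
    and boundary_const_eq: "sqrt (2 * pi) * (1 - boundary_const\<^sup>2) * exp (boundary_const\<^sup>2 / 2)
           * std_normal_cdf boundary_const = boundary_const"
proof -
  define g where "g z = sqrt (2 * pi) * std_normal_cdf z" for z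
  have g_deriv: "(g has_real_derivative exp (- z\<^sup>2 / 2)) (at z)" for z
    unfolding g_def[abs_def] by (rule std_normal_cdf_scaled_derivative)
  define f where "f z = (1 - z\<^sup>2) * g z - z * exp (- z\<^sup>2 / 2)" for z
  have f_iff: "sqrt (2 * pi) * (1 - z\<^sup>2) * exp (z\<^sup>2 / 2) * std_normal_cdf z = z \<longleftrightarrow> f z = 0" for z
  proof -
    have *: "sqrt (2 * pi) * (1 - z\<^sup>2) * exp (z\<^sup>2 / 2) * std_normal_cdf z - z = exp (z\<^sup>2 / 2) * f z"
      by (simp add: f_def g_def algebra_simps exp_minus)
    show ?thesis
      by (subst eq_iff_diff_eq_0, subst *) simp
  qed
  have f_deriv: "(f has_real_derivative - 2 * z * g z) (at z)" for z
    unfolding f_def[abs_def]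
    by (auto intro!: derivative_eq_intros g_deriv simp: algebra_simps power2_eq_square)
  have f_cont: "continuous_on A f" for A
    by (intro continuous_at_imp_continuous_on ballI DERIV_isCont[OF f_deriv])
  have decr: "f y < f z" if "0 \<le> z" "z < y" for y z
  proof (rule DERIV_neg_imp_decreasing_open[OF that(2)])
    fix u assume "z < u" "u < y"
    with that have "- 2 * u * g u < 0"
      using std_normal_cdf_pos[of u] by (simp add: g_def zero_less_mult_iff)
    then show "\<exists>d. DERIV f u :> d \<and> d < 0"
      using f_deriv by blast
  qed (rule f_cont)
  have "0 < f 0" "f 1 < 0"
    using std_normal_cdf_pos[of 0] by (auto simp: f_def g_def)
  then obtain \<alpha> where \<alpha>: "0 \<le> \<alpha>" "\<alpha> \<le> 1" "f \<alpha> = 0"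
    using IVT2'[of f 1 0 0] f_cont by fastforce
  with \<open>0 < f 0\<close> \<open>f 1 < 0\<close> have "0 < \<alpha>" "\<alpha> < 1"
    by (auto simp: order.order_iff_strict)
  moreover have "boundary_const = \<alpha>"
    unfolding boundary_const_def f_iff
  proof (rule the_equality)
    fix \<beta> assume "0 < \<beta> \<and> f \<beta> = 0"
    then show "\<beta> = \<alpha>"
      using decr[of \<alpha> \<beta>] decr[of \<beta> \<alpha>] \<alpha> by (cases \<alpha> \<beta> rule: linorder_cases) auto
  qed (use \<alpha> \<open>0 < \<alpha>\<close> in auto)
  ultimately show "0 < boundary_const" "boundary_const < 1"
    "sqrt (2 * pi) * (1 - boundary_const\<^sup>2) * exp (boundary_const\<^sup>2 / 2)
       * std_normal_cdf boundary_const = boundary_const"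
    using \<alpha>(3) by (auto simp: f_iff)
qed

lemma one_minus_boundary_const_sq_pos: "0 < 1 - boundary_const\<^sup>2"
  using boundary_const_pos boundary_const_less_1 by (simp add: power_less_one_iff)

text \<open>For \<open>z > 0\<close> the difference of the two sides, divided by \<open>exp (z\<^sup>2 / 2)\<close>, has derivative
  \<open>(z\<^sup>2 - \<alpha>\<^sup>2) exp (- z\<^sup>2 / 2)\<close> and therefore its minimum, which is \<open>0\<close>, at \<open>\<alpha>\<close>.\<close>

lemma le_pinned_gain:
  "z \<le> (1 - boundary_const\<^sup>2) * (sqrt (2 * pi) * exp (z\<^sup>2 / 2) * std_normal_cdf z)"
proof (cases "0 \<le> z")
  case False
  then have "z \<le> 0" by simp
  also have "0 \<le> (1 - boundary_const\<^sup>2) * (sqrt (2 * pi) * exp (z\<^sup>2 / 2) * std_normal_cdf z)"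
    using one_minus_boundary_const_sq_pos std_normal_cdf_nonneg[of z]
    by (intro mult_nonneg_nonneg) auto
  finally show ?thesis .
next
  case True
  define \<alpha> where "\<alpha> = boundary_const"
  define g where "g z = sqrt (2 * pi) * std_normal_cdf z" for z
  have g_deriv: "(g has_real_derivative exp (- z\<^sup>2 / 2)) (at z)" for z
    unfolding g_def[abs_def] by (rule std_normal_cdf_scaled_derivative)
  define q where "q y = (1 - \<alpha>\<^sup>2) * g y - y * exp (- y\<^sup>2 / 2)" for y
  have q_deriv: "(q has_real_derivative (y\<^sup>2 - \<alpha>\<^sup>2) * exp (- y\<^sup>2 / 2)) (at y)" for y
    unfolding q_def[abs_def]
    by (auto intro!: derivative_eq_intros g_deriv simp: algebra_simps power2_eq_square)
  have q_eq: "exp (y\<^sup>2 / 2) * q y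
      = (1 - \<alpha>\<^sup>2) * (sqrt (2 * pi) * exp (y\<^sup>2 / 2) * std_normal_cdf y) - y" for y
    by (simp add: q_def g_def algebra_simps exp_minus)
  have "0 < \<alpha>"
    using boundary_const_pos by (simp add: \<alpha>_def)
  have "exp (\<alpha>\<^sup>2 / 2) * q \<alpha> = 0"
    unfolding q_eq using boundary_const_eq by (simp add: \<alpha>_def mult_ac)
  then have "q \<alpha> = 0" by simp
  have "0 \<le> q z"
  proof (cases "z \<le> \<alpha>")
    case z: True
    have "q \<alpha> \<le> q z"
    proof (rule DERIV_nonpos_imp_nonincreasing[of z \<alpha> q, OF z])
      fix y assume "z \<le> y" "y \<le> \<alpha>"
      then have "y\<^sup>2 \<le> \<alpha>\<^sup>2" using True by (intro power_mono) auto
      then show "\<exists>d. DERIV q y :> d \<and> d \<le> 0"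
        by (intro exI[of _ "(y\<^sup>2 - \<alpha>\<^sup>2) * exp (- y\<^sup>2 / 2)"] conjI q_deriv mult_nonpos_nonneg) auto
    qed
    then show ?thesis using \<open>q \<alpha> = 0\<close> by simp
  next
    case z: False
    have "q \<alpha> \<le> q z"
    proof (rule DERIV_nonneg_imp_nondecreasing[of \<alpha> z q])
      fix y assume "\<alpha> \<le> y" "y \<le> z"
      then have "\<alpha>\<^sup>2 \<le> y\<^sup>2" using \<open>0 < \<alpha>\<close> by (intro power_mono) auto
      then show "\<exists>d. DERIV q y :> d \<and> 0 \<le> d"
        by (intro exI[of _ "(y\<^sup>2 - \<alpha>\<^sup>2) * exp (- y\<^sup>2 / 2)"] conjI q_deriv mult_nonneg_nonneg) auto
    qed (use z in auto)
    then show ?thesis using \<open>q \<alpha> = 0\<close> by simp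
  qed
  then have "0 \<le> exp (z\<^sup>2 / 2) * q z" by simp
  then show ?thesis
    unfolding q_eq \<alpha>_def by simp
qed

text \<open>Completing the square: with r = sqrt \<sigma> and z = m / r, the substitution l = (z -
  u) / r turns the exponent into z^2 / 2 - u^2 / 2. As it reverses orientation, the half-line l
  \<ge> 0 becomes u \<le> z, which leaves the normal distribution function at z.\<close>

lemma nn_integral_exp_mixture:
  assumes "0 < \<sigma>"
  shows "(\<integral>\<^sup>+l. ennreal (exp (l * m - l\<^sup>2 * \<sigma> / 2)) * indicator {0..} l \<partial>lborel)
    = ennreal (sqrt (2 * pi / \<sigma>) * exp (m\<^sup>2 / (2 * \<sigma>)) * std_normal_cdf (m / sqrt \<sigma>))"
proof -
  interpret real_distribution std_normal_distribution
    by (rule real_dist_normal_dist)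
  define r z where "r = sqrt \<sigma>" and "z = m / r"
  have r: "0 < r" "\<sigma> = r\<^sup>2" "m = z * r"
    using assms by (auto simp: r_def z_def)
  define K where "K = sqrt (2 * pi) * exp (z\<^sup>2 / 2) / r"
  have "0 \<le> K" using r(1) by (simp add: K_def)
  have "(\<integral>\<^sup>+l. ennreal (exp (l * m - l\<^sup>2 * \<sigma> / 2)) * indicator {0..} l \<partial>lborel)
      = ennreal (1 / r) * (\<integral>\<^sup>+u. ennreal (exp ((z / r + (- 1 / r) * u) * m - (z / r + (- 1 / r) * u)\<^sup>2 * \<sigma> / 2))
          * indicator {0..} (z / r + (- 1 / r) * u) \<partial>lborel)"
    using r(1) by (subst nn_integral_real_affine[where c = "- 1 / r" and t = "z / r"]) auto
  also have "\<dots> = (\<integral>\<^sup>+u. ennreal (1 / r) * (ennreal (exp ((z / r + (- 1 / r) * u) * m - (z / r + (- 1 / r) * u)\<^sup>2 * \<sigma> / 2))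
          * indicator {0..} (z / r + (- 1 / r) * u)) \<partial>lborel)"
    by (rule nn_integral_cmult[symmetric]) auto
  also have "\<dots> = (\<integral>\<^sup>+u. ennreal K * (ennreal (std_normal_density u) * indicator {..z} u) \<partial>lborel)"
  proof (rule nn_integral_cong)
    fix u :: real
    have "(z / r + (- 1 / r) * u) * m - (z / r + (- 1 / r) * u)\<^sup>2 * \<sigma> / 2 = z\<^sup>2 / 2 + - u\<^sup>2 / 2"
    proof -
      have *: "z / r + (- 1 / r) * u = (z - u) / r" by (simp add: diff_divide_distrib)
      show ?thesis unfolding * r(2,3) using r(1)
        by (simp add: power_divide) (simp add: field_simps power2_eq_square)
    qed
    moreover have "indicator {0..} (z / r + (- 1 / r) * u) = (indicator {..z} u :: ennreal)"
      using r(1) by (simp add: indicator_def zero_le_divide_iff flip: diff_divide_distrib)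
    moreover have "1 / r * exp (z\<^sup>2 / 2 + - u\<^sup>2 / 2) = K * std_normal_density u"
      unfolding exp_add K_def std_normal_density_def by simp
    moreover have "ennreal (1 / r) * ennreal (exp (z\<^sup>2 / 2 + - u\<^sup>2 / 2)) = ennreal (1 / r * exp (z\<^sup>2 / 2 + - u\<^sup>2 / 2))"
      "ennreal K * ennreal (std_normal_density u) = ennreal (K * std_normal_density u)"
      using r(1) \<open>0 \<le> K\<close> by (simp_all only: ennreal_mult[symmetric] exp_ge_zero normal_density_nonneg zero_le_divide_1_iff less_imp_le)
    ultimately show "ennreal (1 / r) * (ennreal (exp ((z / r + (- 1 / r) * u) * m - (z / r + (- 1 / r) * u)\<^sup>2 * \<sigma> / 2))
          * indicator {0..} (z / r + (- 1 / r) * u))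
        = ennreal K * (ennreal (std_normal_density u) * indicator {..z} u)"
      by (simp only: mult.assoc[symmetric])
  qed
  also have "\<dots> = ennreal K * emeasure std_normal_distribution {..z}"
    by (simp add: nn_integral_cmult emeasure_density)
  also have "\<dots> = ennreal (K * std_normal_cdf z)"
    using \<open>0 \<le> K\<close> by (simp add: std_normal_cdf_def cdf_def emeasure_eq_measure ennreal_mult)
  also have "K * std_normal_cdf z = sqrt (2 * pi / \<sigma>) * exp (m\<^sup>2 / (2 * \<sigma>)) * std_normal_cdf (m / sqrt \<sigma>)"
  proof -
    have "sqrt (2 * pi / \<sigma>) = sqrt (2 * pi) / r" "m\<^sup>2 / (2 * \<sigma>) = z\<^sup>2 / 2" "m / sqrt \<sigma> = z"
      using r(1) by (simp_all add: real_sqrt_divide r_def z_def power_divide assms less_imp_le)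
    then show ?thesis by (simp add: K_def)
  qed
  finally show ?thesis .
qed

section \<open>Wiener integrals by parts\<close>

text \<open>The integrator \<open>\<beta>\<close> is merely continuous, so the limit of its Riemann--Stieltjes sums is written by
  parts.\<close>

lemma tendsto_left_sums_by_parts:
  fixes w w' \<beta> :: "real \<Rightarrow> real" and k :: "nat \<Rightarrow> nat"
  assumes S: "0 < S"
    and w_deriv: "\<And>r. r \<in> {0..S} \<Longrightarrow> (w has_real_derivative w' r) (at r within {0..S})"
    and w'_cont: "continuous_on {0..S} w'" and w'_nonneg: "\<And>r. r \<in> {0..S} \<Longrightarrow> 0 \<le> w' r"
    and \<beta>_cont: "continuous_on {0..S} \<beta>"
    and k_le: "\<And>n. k n \<le> Suc n"
    and k_lim: "(\<lambda>n. real (k n) * S / real (Suc n)) \<longlonglongrightarrow> s"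
  shows "(\<lambda>n. \<Sum>j<k n. w (real j * S / real (Suc n))
      * (\<beta> (real (Suc j) * S / real (Suc n)) - \<beta> (real j * S / real (Suc n))))
    \<longlonglongrightarrow> w s * \<beta> s - w 0 * \<beta> 0 - integral {0..s} (\<lambda>r. \<beta> r * w' r)"
proof -
  define g where "g n j = real j * S / real (Suc n)" for n j
  have g_mono: "g n i \<le> g n j" if "i \<le> j" for n i j
    using S that by (auto simp: g_def divide_right_mono)
  have g_nonneg: "0 \<le> g n j" for n j
    using S by (simp add: g_def)
  have g_le: "g n j \<le> S" if "j \<le> Suc n" for n j
  proof -
    have "real j * S \<le> real (Suc n) * S" using that S by (intro mult_right_mono) auto
    then show ?thesis by (simp add: g_def pos_divide_le_eq mult.commute)
  qed
  have g_step: "g n (Suc j) = g n j + S / real (Suc n)" for n j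
    by (simp add: g_def add_divide_distrib algebra_simps)
  have g_0: "g n 0 = 0" for n
    by (simp add: g_def)
  have k_lim': "(\<lambda>n. g n (k n)) \<longlonglongrightarrow> s"
    using k_lim by (simp add: g_def)
  have g_in: "g n (k n) \<in> {0..S}" for n
    using g_nonneg g_le k_le by auto
  have s_in: "s \<in> {0..S}"
    by (rule closed_sequentially[OF _ g_in k_lim']) simp
  have w_cont: "continuous_on {0..S} w"
    using w_deriv by (rule DERIV_continuous_on)
  have f_int: "(\<lambda>r. \<beta> r * w' r) integrable_on {c..d}" if "0 \<le> c" "d \<le> S" for c d
    by (rule integrable_continuous_real, rule continuous_on_subset[of "{0..S}"])
      (use that in \<open>auto intro!: continuous_intros w'_cont \<beta>_cont\<close>)
  have w'_has_int: "(w' has_integral (w d - w c)) {c..d}" if "0 \<le> c" "c \<le> d" "d \<le> S" for c d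
    by (rule fundamental_theorem_of_calculus[OF \<open>c \<le> d\<close>])
      (use that in \<open>auto intro!: has_field_derivative_subset[OF w_deriv]
         simp flip: has_real_derivative_iff_has_vector_derivative\<close>)
  \<comment> \<open>Abel summation moves the differences from \<beta> to w and leaves \<beta> at the
    right ends of the cells; only differences of the smooth w are then compared with an
    integral.\<close>
  have by_parts: "(\<Sum>j<m. w (g n j) * (\<beta> (g n (Suc j)) - \<beta> (g n j)))
      = w (g n m) * \<beta> (g n m) - w 0 * \<beta> 0 - (\<Sum>j<m. \<beta> (g n (Suc j)) * (w (g n (Suc j)) - w (g n j)))" for n m
    by (induction m) (simp_all add: g_0 algebra_simps)
  have split_int: "integral {0..g n m} (\<lambda>r. \<beta> r * w' r)
      = (\<Sum>j<m. integral {g n j..g n (Suc j)} (\<lambda>r. \<beta> r * w' r))" if "m \<le> Suc n" for n m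
    using that
  proof (induction m)
    case (Suc m)
    have "integral {0..g n m} (\<lambda>r. \<beta> r * w' r) + integral {g n m..g n (Suc m)} (\<lambda>r. \<beta> r * w' r)
        = integral {0..g n (Suc m)} (\<lambda>r. \<beta> r * w' r)"
      by (rule Henstock_Kurzweil_Integration.integral_combine)
        (use Suc.prems in \<open>auto intro!: g_nonneg g_mono f_int g_le\<close>)
    then show ?case using Suc by simp
  qed (simp add: g_0)
  define E where "E n = (\<Sum>j<k n. \<beta> (g n (Suc j)) * (w (g n (Suc j)) - w (g n j)))
      - integral {0..g n (k n)} (\<lambda>r. \<beta> r * w' r)" for n
  have "E \<longlonglongrightarrow> 0"
  proof (rule LIMSEQ_I)
    fix \<epsilon> :: real assume "0 < \<epsilon>"
    \<comment> \<open>The summand 1 keeps the denominator positive when w is constant, as in the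
      drift case.\<close>
    define e where "e = \<epsilon> / (w S - w 0 + 1)"
    have w_mono: "w c \<le> w d" if "0 \<le> c" "c \<le> d" "d \<le> S" for c d
      using has_integral_nonneg[OF w'_has_int[OF that]] w'_nonneg that by fastforce
    have "0 \<le> w S - w 0" using w_mono[of 0 S] S by simp
    then have "0 < e" using \<open>0 < \<epsilon>\<close> by (simp add: e_def)
    have "uniformly_continuous_on {0..S} \<beta>"
      by (rule compact_uniformly_continuous[OF \<beta>_cont]) simp
    then obtain d where d: "0 < d"
      "\<And>u v. u \<in> {0..S} \<Longrightarrow> v \<in> {0..S} \<Longrightarrow> dist v u < d \<Longrightarrow> dist (\<beta> v) (\<beta> u) < e"
      unfolding uniformly_continuous_on_def using \<open>0 < e\<close> by metis
    have "(\<lambda>n. S / real (Suc n)) \<longlonglongrightarrow> 0"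
      by (rule lim_const_over_n[THEN LIMSEQ_Suc])
    then obtain N where N: "\<And>n. N \<le> n \<Longrightarrow> norm (S / real (Suc n) - 0) < d"
      using d(1) LIMSEQ_D by blast
    show "\<exists>N. \<forall>n\<ge>N. norm (E n - 0) < \<epsilon>"
    proof (intro exI allI impI)
      fix n assume "N \<le> n"
      from N[OF this] S have mesh: "S / real (Suc n) < d" by simp
      have "E n = (\<Sum>j<k n. \<beta> (g n (Suc j)) * (w (g n (Suc j)) - w (g n j))
          - integral {g n j..g n (Suc j)} (\<lambda>r. \<beta> r * w' r))"
        unfolding E_def split_int[OF k_le] by (simp add: sum_subtractf)
      \<comment> \<open>On a cell \<beta> stays within e of its value at the right end. Since w'
        \<ge> 0, this can be integrated against w', and the errors add up to at most e times the
        total increase of w.\<close>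
      also have "norm \<dots> \<le> (\<Sum>j<k n. e * (w (g n (Suc j)) - w (g n j)))"
      proof (rule sum_norm_le)
        fix j assume "j \<in> {..<k n}"
        then have j: "Suc j \<le> Suc n" using k_le[of n] by auto
        let ?I = "{g n j..g n (Suc j)}"
        have I: "0 \<le> g n j" "g n j \<le> g n (Suc j)" "g n (Suc j) \<le> S"
          using g_nonneg g_mono g_le[OF j] by auto
        note wI = w'_has_int[OF I]
        have 1: "((\<lambda>r. \<beta> (g n (Suc j)) * w' r - \<beta> r * w' r) has_integral
            (\<beta> (g n (Suc j)) * (w (g n (Suc j)) - w (g n j)) - integral ?I (\<lambda>r. \<beta> r * w' r))) ?I"
          by (intro has_integral_diff has_integral_mult_right wI integrable_integral f_int I)
        have 2: "((\<lambda>r. e * w' r) has_integral e * (w (g n (Suc j)) - w (g n j))) ?I"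
          by (intro has_integral_mult_right wI)
        have 3: "norm (\<beta> (g n (Suc j)) * w' r - \<beta> r * w' r) \<le> e * w' r" if "r \<in> ?I" for r
        proof -
          have "dist (\<beta> (g n (Suc j))) (\<beta> r) < e"
            using that I mesh g_step[of n j] by (intro d(2)) (auto simp: dist_real_def)
          then have "\<bar>\<beta> (g n (Suc j)) - \<beta> r\<bar> * w' r \<le> e * w' r"
            using that I w'_nonneg[of r] by (intro mult_right_mono) (auto simp: dist_real_def)
          then show ?thesis
            using that I w'_nonneg[of r] by (simp add: abs_mult flip: left_diff_distrib)
        qed
        show "norm (\<beta> (g n (Suc j)) * (w (g n (Suc j)) - w (g n j))
            - integral ?I (\<lambda>r. \<beta> r * w' r)) \<le> e * (w (g n (Suc j)) - w (g n j))"
          using integral_norm_bound_integral[OF has_integral_integrable[OF 1] has_integral_integrable[OF 2] 3]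
          by (simp only: integral_unique[OF 1] integral_unique[OF 2])
      qed
      also have "\<dots> = e * (w (g n (k n)) - w 0)"
        by (simp add: sum_distrib_left[symmetric] sum_lessThan_telescope[of "\<lambda>j. w (g n j)"] g_0)
      also have "\<dots> \<le> e * (w S - w 0)"
        using \<open>0 < e\<close> w_mono[of "g n (k n)" S] g_in by (intro mult_left_mono) auto
      also have "\<dots> < \<epsilon>"
        using \<open>0 \<le> w S - w 0\<close> \<open>0 < \<epsilon>\<close> by (simp add: e_def field_simps)
      finally show "norm (E n - 0) < \<epsilon>" by simp
    qed
  qed
  have at_k: "(\<lambda>n. f (g n (k n))) \<longlonglongrightarrow> f s" if "continuous_on {0..S} f" for f :: "real \<Rightarrow> real"
    using continuous_on_tendsto_compose[OF that k_lim' s_in] g_in by auto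
  have "continuous_on {0..S} (\<lambda>u. integral {0..u} (\<lambda>r. \<beta> r * w' r))"
    by (rule indefinite_integral_continuous_1) (use f_int[of 0 S] in simp)
  then have "(\<lambda>n. w (g n (k n)) * \<beta> (g n (k n)) - w 0 * \<beta> 0
      - (E n + integral {0..g n (k n)} (\<lambda>r. \<beta> r * w' r)))
    \<longlonglongrightarrow> w s * \<beta> s - w 0 * \<beta> 0 - (0 + integral {0..s} (\<lambda>r. \<beta> r * w' r))"
    by (intro tendsto_intros at_k w_cont \<beta>_cont \<open>E \<longlonglongrightarrow> 0\<close>)
  then show ?thesis
    unfolding g_def[symmetric] by_parts by (simp add: E_def)
qed

text \<open>The difference of a solution \<open>y\<close> and its noise \<open>\<beta>\<close> is differentiable, so that
  \<open>(y - \<beta>) / v\<close> with \<open>v r = T - r\<close> has derivative \<open>- \<beta> / v\<^sup>2\<close>.\<close>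

lemma bridge_equation_solution:
  fixes y \<beta> :: "real \<Rightarrow> real"
  assumes s: "0 \<le> s" "s < T"
    and y_cont: "continuous_on {0..s} y" and \<beta>_cont: "continuous_on {0..s} \<beta>" and \<beta>_0: "\<beta> 0 = 0"
    and y_eq: "\<And>r. r \<in> {0..s} \<Longrightarrow> y r = y0 + integral {0..r} (\<lambda>u. - y u / (T - u)) + \<beta> r"
  shows "y s / (T - s) = y0 / T + \<beta> s / (T - s) - integral {0..s} (\<lambda>r. \<beta> r / (T - r)\<^sup>2)"
proof -
  define z where "z r = y0 + integral {0..r} (\<lambda>u. - y u / (T - u))" for r
  have zy: "z r = y r - \<beta> r" if "r \<in> {0..s}" for r
    using y_eq[OF that] by (simp add: z_def)
  have "continuous_on {0..s} (\<lambda>u. - y u / (T - u))"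
    using s by (intro continuous_intros y_cont) auto
  then have int_deriv: "((\<lambda>r. integral {0..r} (\<lambda>u. - y u / (T - u))) has_real_derivative - y r / (T - r)) (at r within {0..s})"
    if "r \<in> {0..s}" for r
    using that by (rule integral_has_real_derivative)
  have z_deriv: "(z has_real_derivative - y r / (T - r)) (at r within {0..s})"
    if "r \<in> {0..s}" for r
    unfolding z_def[abs_def] using DERIV_add[OF DERIV_const int_deriv[OF that]] by simp
  have "((\<lambda>r. z r / (T - r)) has_real_derivative - \<beta> r / (T - r)\<^sup>2) (at r within {0..s})"
    if r: "r \<in> {0..s}" for r
  proof -
    have "T - r \<noteq> 0" using r s by auto
    have "((\<lambda>r. z r / (T - r)) has_real_derivative
        ((- y r / (T - r)) * (T - r) - z r * (0 - 1)) / ((T - r) * (T - r))) (at r within {0..s})"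
      using \<open>T - r \<noteq> 0\<close> by (intro DERIV_divide z_deriv[OF r] derivative_intros)
    also have "((- y r / (T - r)) * (T - r) - z r * (0 - 1)) / ((T - r) * (T - r)) = - \<beta> r / (T - r)\<^sup>2"
      using \<open>T - r \<noteq> 0\<close> zy[OF r] by (simp add: power2_eq_square)
    finally show ?thesis .
  qed
  then have "((\<lambda>r. - \<beta> r / (T - r)\<^sup>2) has_integral (z s / (T - s) - z 0 / (T - 0))) {0..s}"
    using s by (intro fundamental_theorem_of_calculus)
      (auto simp flip: has_real_derivative_iff_has_vector_derivative)
  then have "integral {0..s} (\<lambda>r. - \<beta> r / (T - r)\<^sup>2) = z s / (T - s) - z 0 / T"
    by (simp only: integral_unique diff_zero)
  moreover have "integral {0..s} (\<lambda>r. - \<beta> r / (T - r)\<^sup>2) = - integral {0..s} (\<lambda>r. \<beta> r / (T - r)\<^sup>2)"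
    by (simp add: integral_neg[symmetric] del: integral_neg)
  moreover have "z 0 = y0" by (simp add: z_def)
  ultimately show ?thesis
    using zy[of s] s by (simp add: diff_divide_distrib)
qed

text \<open>The kernel 1 / (T - r)^2 has antiderivative 1 / (T - r), so the integral is at most D /
  (T - s). Solving for y s multiplies it by T - s, which cancels the singularity; the bound is
  therefore uniform in s and survives the limit s to T.\<close>

lemma bridge_solution_bound:
  fixes y \<beta> :: "real \<Rightarrow> real"
  assumes s: "0 \<le> s" "s < T"
    and \<beta>_cont: "continuous_on {0..s} \<beta>" and \<beta>_le: "\<And>r. r \<in> {0..s} \<Longrightarrow> \<bar>\<beta> r\<bar> \<le> D"
    and eq: "y s / (T - s) = y0 / T + \<beta> s / (T - s) - integral {0..s} (\<lambda>r. \<beta> r / (T - r)\<^sup>2)"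
  shows "\<bar>y s\<bar> \<le> \<bar>y0\<bar> + 2 * D"
proof -
  have D: "0 \<le> D" using \<beta>_le[of 0] s by auto
  have int: "((\<lambda>r. D / (T - r)\<^sup>2) has_integral (D / (T - s) - D / (T - 0))) {0..s}"
  proof (rule fundamental_theorem_of_calculus)
    fix r assume "r \<in> {0..s}"
    then have "T - r \<noteq> 0" using s by auto
    then have "((\<lambda>r. D / (T - r)) has_real_derivative D / (T - r)\<^sup>2) (at r within {0..s})"
      by (auto intro!: derivative_eq_intros simp: power2_eq_square)
    then show "((\<lambda>r. D / (T - r)) has_vector_derivative D / (T - r)\<^sup>2) (at r within {0..s})"
      by (simp add: has_real_derivative_iff_has_vector_derivative)
  qed (use s in auto)
  have "continuous_on {0..s} (\<lambda>r. \<beta> r / (T - r)\<^sup>2)"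
    using s by (intro continuous_intros \<beta>_cont) auto
  then have "norm (integral {0..s} (\<lambda>r. \<beta> r / (T - r)\<^sup>2)) \<le> integral {0..s} (\<lambda>r. D / (T - r)\<^sup>2)"
    using int \<beta>_le
    by (intro integral_norm_bound_integral)
      (auto intro!: integrable_continuous_real divide_right_mono simp: has_integral_integrable)
  also have "\<dots> = D / (T - s) - D / T"
    using int by (simp add: integral_unique)
  finally have I: "\<bar>integral {0..s} (\<lambda>r. \<beta> r / (T - r)\<^sup>2)\<bar> \<le> D / (T - s)"
    using D s by (smt (verit) divide_nonneg_nonneg real_norm_def)
  have ys: "y s = (T - s) / T * y0 + \<beta> s - (T - s) * integral {0..s} (\<lambda>r. \<beta> r / (T - r)\<^sup>2)"
  proof -
    have "y s = (T - s) * (y s / (T - s))" using s by simp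
    also have "\<dots> = (T - s) / T * y0 + \<beta> s - (T - s) * integral {0..s} (\<lambda>r. \<beta> r / (T - r)\<^sup>2)"
    proof -
      have "(T - s) * (\<beta> s / (T - s)) = \<beta> s" using s by simp
      then show ?thesis
        unfolding eq by (simp add: right_diff_distrib distrib_left)
    qed
    finally show ?thesis .
  qed
  have "\<bar>(T - s) / T * y0\<bar> \<le> 1 * \<bar>y0\<bar>"
    unfolding abs_mult using s by (intro mult_right_mono) auto
  moreover have "\<bar>(T - s) * integral {0..s} (\<lambda>r. \<beta> r / (T - r)\<^sup>2)\<bar> \<le> (T - s) * (D / (T - s))"
    unfolding abs_mult using s I by (intro mult_mono) auto
  moreover have "(T - s) * (D / (T - s)) = D" using s by simp
  moreover have "\<bar>\<beta> s\<bar> \<le> D" using \<beta>_le s by auto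
  ultimately show ?thesis
    unfolding ys by linarith
qed

section \<open>Exponential supermartingales\<close>

text \<open>The preimage sigma-algebras of f and g lie inside F and G, so f and g are independent.
  \<open>case_bool\<close> presents them as a family over the booleans, the shape in which the
  product rule for independent families applies.\<close>

lemma (in prob_space) indep_set_nn_integral_mult:
  fixes f g :: "'a \<Rightarrow> ennreal"
  assumes indep: "indep_set (sets F) (sets G)" and F: "subalgebra M F" and G: "subalgebra M G"
    and f: "f \<in> borel_measurable F" and g: "g \<in> borel_measurable G"
  shows "(\<integral>\<^sup>+\<omega>. f \<omega> * g \<omega> \<partial>M) = (\<integral>\<^sup>+\<omega>. f \<omega> \<partial>M) * (\<integral>\<^sup>+\<omega>. g \<omega> \<partial>M)"
proof -
  have subset: "sigma_sets (space M) {h -` A \<inter> space M |A. A \<in> sets borel} \<subseteq> sets H"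
    if "subalgebra M H" "h \<in> borel_measurable H" for H and h :: "'a \<Rightarrow> ennreal"
  proof -
    have sp: "space H = space M" using that(1) by (simp add: subalgebra_def)
    have "{h -` A \<inter> space H |A. A \<in> sets borel} \<subseteq> sets H"
      using that(2) by (auto intro: measurable_sets)
    from sets.sigma_sets_subset[OF this] show ?thesis by (simp only: sp)
  qed
  note f_sets = subset[OF F f] and g_sets = subset[OF G g]
  have "indep_set (sigma_sets (space M) {f -` A \<inter> space M |A. A \<in> sets borel})
      (sigma_sets (space M) {g -` A \<inter> space M |A. A \<in> sets borel})"
  proof (rule indep_setI)
    show "sigma_sets (space M) {f -` A \<inter> space M |A. A \<in> sets borel} \<subseteq> events"
      using f_sets F unfolding subalgebra_def by (meson order_trans)
    show "sigma_sets (space M) {g -` A \<inter> space M |A. A \<in> sets borel} \<subseteq> events"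
      using g_sets G unfolding subalgebra_def by (meson order_trans)
  qed (rule indep_setD[OF indep subsetD[OF f_sets] subsetD[OF g_sets]])
  then have "indep_var borel f borel g"
    unfolding indep_var_eq
    by (intro conjI measurable_from_subalg[OF F f] measurable_from_subalg[OF G g])
  moreover have "(\<lambda>_. borel) = case_bool borel (borel :: ennreal measure)"
    by (rule ext) (simp split: bool.split)
  ultimately have "indep_vars (\<lambda>_. borel) (case_bool f g) UNIV"
    unfolding indep_var_def by simp
  from indep_vars_nn_integral[OF _ this] show ?thesis
    by (simp add: UNIV_bool mult.commute)
qed

text \<open>Exponential tilting: completing the square turns the density times exp (c y) into exp
  (c^2 s^2 / 2) times the normal density with mean c s^2, which has mass 1.\<close>

lemma nn_integral_exp_normal_density:
  assumes "0 < s"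
  shows "(\<integral>\<^sup>+y. ennreal (normal_density 0 s y) * ennreal (exp (c * y)) \<partial>lborel) = ennreal (exp (c\<^sup>2 * s\<^sup>2 / 2))"
proof -
  have "normal_density 0 s y * exp (c * y) = exp (c\<^sup>2 * s\<^sup>2 / 2) * normal_density (c * s\<^sup>2) s y" for y
  proof -
    have "- (y - 0)\<^sup>2 / (2 * s\<^sup>2) + c * y = c\<^sup>2 * s\<^sup>2 / 2 + - (y - c * s\<^sup>2)\<^sup>2 / (2 * s\<^sup>2)"
      using assms by (simp add: field_simps) (simp add: power2_eq_square power4_eq_xxxx algebra_simps)
    then have "exp (- (y - 0)\<^sup>2 / (2 * s\<^sup>2)) * exp (c * y) = exp (c\<^sup>2 * s\<^sup>2 / 2) * exp (- (y - c * s\<^sup>2)\<^sup>2 / (2 * s\<^sup>2))"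
      by (simp only: exp_add[symmetric])
    then show ?thesis
      unfolding normal_density_def by simp
  qed
  then have "(\<integral>\<^sup>+y. ennreal (normal_density 0 s y) * ennreal (exp (c * y)) \<partial>lborel)
      = (\<integral>\<^sup>+y. ennreal (exp (c\<^sup>2 * s\<^sup>2 / 2)) * ennreal (normal_density (c * s\<^sup>2) s y) \<partial>lborel)"
    by (simp flip: ennreal_mult)
  also have "\<dots> = ennreal (exp (c\<^sup>2 * s\<^sup>2 / 2)) * emeasure (density lborel (normal_density (c * s\<^sup>2) s)) UNIV"
    by (simp add: nn_integral_cmult emeasure_density)
  also have "emeasure (density lborel (normal_density (c * s\<^sup>2) s)) UNIV = 1"
    using prob_space.emeasure_space_1[OF prob_space_normal_density[OF assms, of "c * s\<^sup>2"]] by simp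
  finally show ?thesis by simp
qed

section \<open>Generated sigma-algebras and their comparison up to null sets\<close>

lemma space_generated [simp]: "space (generated M Y I) = space M"
  unfolding generated_def by (rule space_measure_of) auto

lemma sets_generated:
  "sets (generated M Y I) = sigma_sets (space M) {Y r -` A \<inter> space M | r A. r \<in> I \<and> A \<in> sets borel}"
  unfolding generated_def by (rule sets_measure_of) auto

lemma measurable_generated: "r \<in> I \<Longrightarrow> Y r \<in> borel_measurable (generated M Y I)"
  by (rule measurableI) (auto simp: sets_generated)

lemma subalgebra_generated_mono: "I \<subseteq> J \<Longrightarrow> subalgebra (generated M Y J) (generated M Y I)"
  unfolding subalgebra_def by (auto simp: sets_generated intro!: sigma_sets_mono')

lemma subalgebra_generated:
  assumes "\<And>r. r \<in> I \<Longrightarrow> Y r \<in> borel_measurable M"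
  shows "subalgebra M (generated M Y I)"
proof -
  have "{Y r -` A \<inter> space M | r A. r \<in> I \<and> A \<in> sets borel} \<subseteq> sets M"
    using assms by (auto intro: measurable_sets)
  then show ?thesis
    unfolding subalgebra_def sets_generated by (simp add: sets.sigma_sets_subset)
qed

text \<open>Transfers events of the observation to events of the noise; A will be a \<theta>-event.
  The sets that agree on A, up to a null set, with a member of F are closed under complements and
  countable unions, so only generators matter, and for these the preimage under the version g
  serves.\<close>

lemma generated_AE_cong:
  assumes Y: "\<And>r. r \<in> I \<Longrightarrow> \<exists>g\<in>borel_measurable F. AE \<omega> in M. \<omega> \<in> A \<longrightarrow> Y r \<omega> = g \<omega>"
    and space_F: "space F = space M" and E: "E \<in> sets (generated M Y I)"
  shows "\<exists>E'\<in>sets F. AE \<omega> in M. \<omega> \<in> A \<longrightarrow> (\<omega> \<in> E \<longleftrightarrow> \<omega> \<in> E')"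
  using E unfolding sets_generated
proof (induction rule: sigma_sets.induct)
  case (Basic E)
  then obtain r C where r: "E = Y r -` C \<inter> space M" "r \<in> I" "C \<in> sets borel" by auto
  obtain g where g: "g \<in> borel_measurable F" "AE \<omega> in M. \<omega> \<in> A \<longrightarrow> Y r \<omega> = g \<omega>"
    using Y[OF r(2)] by blast
  show ?case
  proof
    show "g -` C \<inter> space M \<in> sets F"
      using measurable_sets[OF g(1) r(3)] by (simp add: space_F)
    show "AE \<omega> in M. \<omega> \<in> A \<longrightarrow> (\<omega> \<in> E \<longleftrightarrow> \<omega> \<in> g -` C \<inter> space M)"
      using g(2) by (auto simp: r(1))
  qed
next
  case Empty
  show ?case by (rule bexI[of _ "{}"]) auto
next
  case (Compl E)
  then obtain E' where E': "E' \<in> sets F" "AE \<omega> in M. \<omega> \<in> A \<longrightarrow> (\<omega> \<in> E \<longleftrightarrow> \<omega> \<in> E')" by blast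
  have "space M - E' \<in> sets F"
    using E'(1) by (metis sets.compl_sets space_F)
  moreover have "AE \<omega> in M. \<omega> \<in> A \<longrightarrow> (\<omega> \<in> space M - E \<longleftrightarrow> \<omega> \<in> space M - E')"
    using E'(2) by eventually_elim auto
  ultimately show ?case by blast
next
  case (Union E)
  then have "\<forall>i. \<exists>E'. E' \<in> sets F \<and> (AE \<omega> in M. \<omega> \<in> A \<longrightarrow> (\<omega> \<in> E i \<longleftrightarrow> \<omega> \<in> E'))"
    unfolding Bex_def by simp
  then obtain E' where E': "\<forall>i. E' i \<in> sets F \<and> (AE \<omega> in M. \<omega> \<in> A \<longrightarrow> (\<omega> \<in> E i \<longleftrightarrow> \<omega> \<in> E' i))"
    by (rule choice[THEN exE])
  have "AE \<omega> in M. \<forall>i::nat. \<omega> \<in> A \<longrightarrow> (\<omega> \<in> E i \<longleftrightarrow> \<omega> \<in> E' i)"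
    by (rule AE_all_countable[THEN iffD2]) (use E' in simp)
  then have "AE \<omega> in M. \<omega> \<in> A \<longrightarrow> (\<omega> \<in> (\<Union>i. E i) \<longleftrightarrow> \<omega> \<in> (\<Union>i. E' i))"
    by eventually_elim auto
  moreover have "(\<Union>i. E' i) \<in> sets F" using E' by auto
  ultimately show ?case by blast
qed

context prob_space
begin

lemma standard_brownian_motionD:
  assumes "standard_brownian_motion B"
  shows brownian_measurable: "\<And>u. 0 \<le> u \<Longrightarrow> random_variable borel (B u)"
    and brownian_continuous: "AE \<omega> in M. continuous_on {0..} (\<lambda>u. B u \<omega>)"
    and brownian_increment: "\<And>u v. 0 \<le> u \<Longrightarrow> u < v \<Longrightarrow>
        distributed M lborel (\<lambda>\<omega>. B v \<omega> - B u \<omega>) (normal_density 0 (sqrt (v - u)))"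
    and brownian_indep: "\<And>u v. 0 \<le> u \<Longrightarrow> u < v \<Longrightarrow>
        indep_set (sets (generated M B {0..u}))
                  (sets (vimage_algebra (space M) (\<lambda>\<omega>. B v \<omega> - B u \<omega>) borel))"
  using assms unfolding standard_brownian_motion_def by blast+

lemma subalgebra_brownian:
  assumes "standard_brownian_motion B" "I \<subseteq> {0..}"
  shows "subalgebra M (generated M B I)"
  by (rule subalgebra_generated) (use assms brownian_measurable in auto)

lemma subalgebra_vimage_algebra:
  fixes Z :: "'a \<Rightarrow> real"
  assumes "random_variable borel Z"
  shows "subalgebra M (vimage_algebra (space M) Z borel)"
  using assms measurable_sets unfolding subalgebra_def
  by (auto simp: sets_vimage_algebra2)

text \<open>The increment has Laplace transform exp (c^2 (v - u) / 2), so any compensator d at least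
  as large as this exponent works. The slack serves grid sums, where the squared integrand at the
  left end times the step is only bounded by the increment of q.\<close>

lemma nn_integral_exp_brownian_increment_le_1:
  assumes B: "standard_brownian_motion B" and uv: "0 \<le> u" "u < v" and d: "c\<^sup>2 * (v - u) / 2 \<le> d"
  shows "(\<integral>\<^sup>+\<omega>. ennreal (exp (c * (B v \<omega> - B u \<omega>) - d)) \<partial>M) \<le> 1"
proof -
  have [measurable]: "random_variable borel (B u)" "random_variable borel (B v)"
    using brownian_measurable[OF B] uv by auto
  have "(\<integral>\<^sup>+\<omega>. ennreal (exp (c * (B v \<omega> - B u \<omega>) - d)) \<partial>M)
      = (\<integral>\<^sup>+\<omega>. ennreal (exp (- d)) * ennreal (exp (c * (B v \<omega> - B u \<omega>))) \<partial>M)"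
    by (simp add: exp_diff exp_minus divide_inverse mult.commute flip: ennreal_mult)
  also have "\<dots> = ennreal (exp (- d)) * (\<integral>\<^sup>+\<omega>. ennreal (exp (c * (B v \<omega> - B u \<omega>))) \<partial>M)"
    by (rule nn_integral_cmult) measurable
  also have "(\<integral>\<^sup>+\<omega>. ennreal (exp (c * (B v \<omega> - B u \<omega>))) \<partial>M) = ennreal (exp (c\<^sup>2 * (v - u) / 2))"
    using distributed_nn_integral[OF brownian_increment[OF B uv], of "\<lambda>y. ennreal (exp (c * y))"]
      nn_integral_exp_normal_density[of "sqrt (v - u)" c] uv by simp
  also have "ennreal (exp (- d)) * ennreal (exp (c\<^sup>2 * (v - u) / 2)) \<le> 1"
    using d by (simp flip: ennreal_mult exp_add)
  finally show ?thesis .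
qed

text \<open>Switching the factors off outside events of the past keeps the supermartingale property; a
  stopped exponential martingale is the special case in which the events are decreasing.\<close>

lemma nn_integral_switched_exp_le_1:
  assumes B: "standard_brownian_motion B" and g: "0 \<le> g 0" "\<And>j. g j < g (Suc j)"
    and d: "\<And>j. j < n \<Longrightarrow> (c j)\<^sup>2 * (g (Suc j) - g j) / 2 \<le> d j"
    and H: "\<And>j. j < n \<Longrightarrow> H j \<in> sets (generated M B {0..g j})"
  defines "P \<equiv> \<lambda>n \<omega>. \<Prod>j<n. ennreal (exp (indicator (H j) \<omega> * (c j * (B (g (Suc j)) \<omega> - B (g j) \<omega>) - d j)))"
  shows "P n \<in> borel_measurable (generated M B {0..g n})" and "(\<integral>\<^sup>+\<omega>. P n \<omega> \<partial>M) \<le> 1"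
proof -
  have mono: "strict_mono g" using g(2) by (rule strict_mono_Suc_iff[THEN iffD2, rule_format])
  have g_nonneg: "0 \<le> g j" for j
    using g(1) strict_mono_less_eq[OF mono, of 0 j] by (auto intro: order_trans)
  note mono_le = strict_mono_less_eq[OF mono, THEN iffD2]
  have Pm: "P m \<in> borel_measurable (generated M B {0..g m'})" if "m \<le> n" "m \<le> m'" for m m'
    unfolding P_def
  proof (intro borel_measurable_prod_ennreal)
    fix j assume "j \<in> {..<m}"
    then have j: "j < n" "Suc j \<le> m'" using that by auto
    have [measurable]: "B (g j) \<in> borel_measurable (generated M B {0..g m'})"
      "B (g (Suc j)) \<in> borel_measurable (generated M B {0..g m'})"
      using j g_nonneg by (auto intro!: measurable_generated mono_le)
    have "subalgebra (generated M B {0..g m'}) (generated M B {0..g j})"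
      using j by (intro subalgebra_generated_mono) (auto intro: order_trans[OF _ mono_le[of j m']])
    with H[OF j(1)] have [measurable]: "H j \<in> sets (generated M B {0..g m'})"
      by (auto simp: subalgebra_def)
    show "(\<lambda>\<omega>. ennreal (exp (indicator (H j) \<omega> * (c j * (B (g (Suc j)) \<omega> - B (g j) \<omega>) - d j))))
        \<in> borel_measurable (generated M B {0..g m'})"
      by measurable
  qed
  from Pm[of n n] show "P n \<in> borel_measurable (generated M B {0..g n})" by simp
  have "(\<integral>\<^sup>+\<omega>. P m \<omega> \<partial>M) \<le> 1" if "m \<le> n" for m
    using that
  proof (induction m)
    case 0
    then show ?case by (simp add: P_def emeasure_space_1)
  next
    case (Suc m)
    then have m: "m < n" by simp
    let ?\<xi> = "\<lambda>\<omega>. B (g (Suc m)) \<omega> - B (g m) \<omega>"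
    let ?e = "\<lambda>\<omega>. ennreal (exp (c m * ?\<xi> \<omega> - d m))"
    let ?F = "generated M B {0..g m}" and ?G = "vimage_algebra (space M) ?\<xi> borel"
    have F: "subalgebra M ?F"
      by (rule subalgebra_brownian[OF B]) auto
    have \<xi>: "random_variable borel ?\<xi>"
      using brownian_measurable[OF B] g_nonneg by (intro borel_measurable_diff) auto
    have G: "subalgebra M ?G"
      by (rule subalgebra_vimage_algebra[OF \<xi>])
    have Hm: "H m \<in> sets ?F" by (rule H[OF m])
    have PF: "P m \<in> borel_measurable ?F" using Pm[of m m] m by simp
    have [measurable]: "P m \<in> borel_measurable M" "H m \<in> sets M"
      using measurable_from_subalg[OF F PF] F Hm by (auto simp: subalgebra_def)
    have PH: "(\<lambda>\<omega>. P m \<omega> * indicator (H m) \<omega>) \<in> borel_measurable ?F"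
      using PF Hm by measurable
    have eG: "?e \<in> borel_measurable ?G"
    proof -
      have [measurable]: "?\<xi> \<in> borel_measurable ?G"
        by (rule measurable_vimage_algebra1) simp
      show ?thesis by measurable
    qed
    note [measurable] = measurable_from_subalg[OF G eG]
    \<comment> \<open>Off \<open>H m\<close> the new factor is exp 0 = 1. On \<open>H m\<close> it
      depends only on the increment after \<open>g m\<close>, which is independent of
      \<open>P m\<close> and \<open>H m\<close>.\<close>
    have "(\<integral>\<^sup>+\<omega>. P (Suc m) \<omega> \<partial>M)
        = (\<integral>\<^sup>+\<omega>. P m \<omega> * indicator (space M - H m) \<omega> + (P m \<omega> * indicator (H m) \<omega>) * ?e \<omega> \<partial>M)"
      by (rule nn_integral_cong) (auto simp: P_def indicator_def)
    also have "\<dots> = (\<integral>\<^sup>+\<omega>. P m \<omega> * indicator (space M - H m) \<omega> \<partial>M)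
        + (\<integral>\<^sup>+\<omega>. (P m \<omega> * indicator (H m) \<omega>) * ?e \<omega> \<partial>M)"
      by (rule nn_integral_add) measurable
    also have "(\<integral>\<^sup>+\<omega>. (P m \<omega> * indicator (H m) \<omega>) * ?e \<omega> \<partial>M)
        = (\<integral>\<^sup>+\<omega>. P m \<omega> * indicator (H m) \<omega> \<partial>M) * (\<integral>\<^sup>+\<omega>. ?e \<omega> \<partial>M)"
      by (rule indep_set_nn_integral_mult[OF _ F G PH eG])
        (rule brownian_indep[OF B g_nonneg g(2)])
    also have "\<dots> \<le> (\<integral>\<^sup>+\<omega>. P m \<omega> * indicator (H m) \<omega> \<partial>M) * 1"
      by (intro mult_left_mono nn_integral_exp_brownian_increment_le_1[OF B g_nonneg g(2) d[OF m]]) simp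
    also have "(\<integral>\<^sup>+\<omega>. P m \<omega> * indicator (space M - H m) \<omega> \<partial>M)
        + (\<integral>\<^sup>+\<omega>. P m \<omega> * indicator (H m) \<omega> \<partial>M) * 1
        = (\<integral>\<^sup>+\<omega>. P m \<omega> * indicator (space M - H m) \<omega> + P m \<omega> * indicator (H m) \<omega> \<partial>M)"
      by (subst nn_integral_add) auto
    also have "\<dots> = (\<integral>\<^sup>+\<omega>. P m \<omega> \<partial>M)"
      by (rule nn_integral_cong) (auto simp: indicator_def)
    also have "\<dots> \<le> 1" using Suc by simp
    finally show ?case by simp
  qed
  then show "(\<integral>\<^sup>+\<omega>. P n \<omega> \<partial>M) \<le> 1" by simp
qed

end

section \<open>The supremum of Brownian motion\<close>

text \<open>\<open>\<bar>\<Delta>\<bar>\<close> is at most \<open>\<epsilon>\<close> or at most \<open>\<Delta>\<^sup>4 / \<epsilon>\<^sup>3\<close>, so a maximum of increments is dominated by a sum of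
  fourth powers.\<close>

lemma abs_le_threshold_plus_fourth_power:
  fixes z \<epsilon> :: real
  assumes "0 < \<epsilon>"
  shows "\<bar>z\<bar> \<le> \<epsilon> + z ^ 4 / \<epsilon> ^ 3"
proof (cases "\<bar>z\<bar> \<le> \<epsilon>")
  case True
  moreover have "0 \<le> z ^ 4 / \<epsilon> ^ 3" using assms by simp
  ultimately show ?thesis by linarith
next
  case False
  then have "\<epsilon> ^ 3 \<le> \<bar>z\<bar> ^ 3" using assms by (intro power_mono) auto
  then have "\<bar>z\<bar> * \<epsilon> ^ 3 \<le> \<bar>z\<bar> * \<bar>z\<bar> ^ 3" by (rule mult_left_mono) simp
  also have "\<bar>z\<bar> * \<bar>z\<bar> ^ 3 = z ^ 4"
    by (simp add: power_even_abs flip: power_Suc)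
  finally have "\<bar>z\<bar> \<le> z ^ 4 / \<epsilon> ^ 3" using assms by (simp add: pos_le_divide_eq)
  then show ?thesis using assms by linarith
qed

text \<open>Induction on the level: an even point of level n + 1 already belongs to level n, and an
  odd one lies one step to the right of such a point, at the cost of one increment of size at most u
  (n + 1).\<close>

lemma dyadic_chaining:
  fixes f :: "real \<Rightarrow> real" and u :: "nat \<Rightarrow> real"
  assumes f_0: "f 0 = 0" and u_nonneg: "\<And>n. 0 \<le> u n"
    and u: "\<And>n k. k < 2 ^ n \<Longrightarrow>
      \<bar>f (real (Suc k) * T / 2 ^ n) - f (real k * T / 2 ^ n)\<bar> \<le> u n"
  shows "k \<le> 2 ^ n \<Longrightarrow> \<bar>f (real k * T / 2 ^ n)\<bar> \<le> (\<Sum>m\<le>n. u m)"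
proof (induction n arbitrary: k)
  case 0
  then consider "k = 0" | "k = 1" by fastforce
  then show ?case
    using u[of 0 0] u_nonneg[of 0] f_0 by cases auto
next
  case (Suc n)
  have half: "real (2 * i) * T / 2 ^ Suc n = real i * T / 2 ^ n" for i by simp
  show ?case
  proof (cases "even k")
    case True
    then obtain i where i: "k = 2 * i" by blast
    show ?thesis
      unfolding i half using Suc.IH[of i] Suc.prems i u_nonneg[of "Suc n"] by simp
  next
    case False
    then obtain i where i: "k = Suc (2 * i)" by (auto elim: oddE)
    have "\<bar>f (real k * T / 2 ^ Suc n) - f (real i * T / 2 ^ n)\<bar> \<le> u (Suc n)"
      using u[of "2 * i" "Suc n"] Suc.prems unfolding i half by simp
    moreover have "\<bar>f (real i * T / 2 ^ n)\<bar> \<le> (\<Sum>m\<le>n. u m)"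
      using Suc.IH[of i] Suc.prems i by simp
    ultimately show ?thesis by (simp only: sum.atMost_Suc)
  qed
qed

text \<open>Rounding s down to level n gives dyadic points converging to s, and continuity carries
  the chaining bound along.\<close>

lemma dyadic_chaining_continuous:
  fixes f :: "real \<Rightarrow> real" and u :: "nat \<Rightarrow> real"
  assumes "f 0 = 0" and u_nonneg: "\<And>n. 0 \<le> u n"
    and "\<And>n k. k < 2 ^ n \<Longrightarrow>
      \<bar>f (real (Suc k) * T / 2 ^ n) - f (real k * T / 2 ^ n)\<bar> \<le> u n"
    and cont: "continuous_on {0..T} f" and D: "\<And>n. (\<Sum>m\<le>n. u m) \<le> D" and T: "0 < T" and s: "s \<in> {0..T}"
  shows "\<bar>f s\<bar> \<le> D"
proof -
  define k where "k n = nat \<lfloor>s * 2 ^ n / T\<rfloor>" for n :: nat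
  have "0 \<le> s / T" "s / T \<le> 1" using s T by auto
  have k_le: "real (k n) \<le> s * 2 ^ n / T" "s * 2 ^ n / T < real (k n) + 1" for n
    using s T by (auto simp: k_def)
  have "s * 2 ^ n / T \<le> 2 ^ n" for n
    using s T by (simp add: pos_divide_le_eq)
  then have "real (k n) \<le> 2 ^ n" for n
    by (rule order_trans[OF k_le(1)])
  then have k_le_2: "k n \<le> 2 ^ n" for n
    by (simp only: of_nat_le_iff[where 'a = real, symmetric] of_nat_power of_nat_numeral)
  have upper: "real (k n) * T / 2 ^ n \<le> s" for n
    using k_le(1)[of n] T by (simp add: field_simps)
  have lower: "s - T * (1 / 2) ^ n \<le> real (k n) * T / 2 ^ n" for n
  proof -
    have "s * 2 ^ n - T \<le> real (k n) * T"
      using k_le(2)[of n] T by (simp add: field_simps)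
    then have "(s * 2 ^ n - T) / 2 ^ n \<le> real (k n) * T / 2 ^ n"
      by (rule divide_right_mono) simp
    then show ?thesis by (simp add: diff_divide_distrib power_one_over)
  qed
  have "(\<lambda>n. s - T * (1 / 2) ^ n) \<longlonglongrightarrow> s - T * 0"
    by (intro tendsto_intros LIMSEQ_power_zero) simp
  then have "(\<lambda>n. s - T * (1 / 2) ^ n) \<longlonglongrightarrow> s" by simp
  from tendsto_sandwich[OF always_eventually[OF allI[OF lower]] always_eventually[OF allI[OF upper]] this tendsto_const]
  have lim: "(\<lambda>n. real (k n) * T / 2 ^ n) \<longlonglongrightarrow> s" .
  have "real (k n) * T / 2 ^ n \<in> {0..T}" for n
    using upper[of n] s T by simp
  then have "(\<lambda>n. f (real (k n) * T / 2 ^ n)) \<longlonglongrightarrow> f s"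
    by (intro continuous_on_tendsto_compose[OF cont lim s] always_eventually allI)
  then have "(\<lambda>n. \<bar>f (real (k n) * T / 2 ^ n)\<bar>) \<longlonglongrightarrow> \<bar>f s\<bar>"
    by (rule tendsto_rabs)
  moreover have "\<bar>f (real (k n) * T / 2 ^ n)\<bar> \<le> D" for n
    by (rule order_trans[OF dyadic_chaining[OF assms(1-3) k_le_2] D])
  ultimately show ?thesis
    by (intro LIMSEQ_le_const2[of _ "\<bar>f s\<bar>" D] exI allI impI)
qed

context prob_space
begin

text \<open>The fourth moment is of the order of the squared step length, which beats the number 2^n
  of cells of level n in the chaining bound; second moments would not.\<close>

lemma nn_integral_brownian_increment_fourth_power:
  assumes B: "standard_brownian_motion B" and uv: "0 \<le> u" "u < v"
  shows "(\<integral>\<^sup>+\<omega>. ennreal ((B v \<omega> - B u \<omega>) ^ 4) \<partial>M) = ennreal (3 * (v - u)\<^sup>2)"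
proof -
  let ?\<sigma> = "sqrt (v - u)"
  have "0 < ?\<sigma>" using uv by simp
  note moment = normal_moment_even[OF this, of 0 2]
  have "(\<integral>\<^sup>+\<omega>. ennreal ((B v \<omega> - B u \<omega>) ^ 4) \<partial>M)
      = (\<integral>\<^sup>+y. ennreal (normal_density 0 ?\<sigma> y * (y - 0) ^ (2 * 2)) \<partial>lborel)"
    using distributed_nn_integral[OF brownian_increment[OF B uv], of "\<lambda>y. ennreal (y ^ 4)"]
    by (simp add: ennreal_mult)
  also have "\<dots> = ennreal (fact (2 * 2) / ((2 / ?\<sigma>\<^sup>2) ^ 2 * fact 2))"
    by (subst nn_integral_eq_integral[OF integrable.intros[OF moment]])
      (simp_all only: has_bochner_integral_integral_eq[OF moment], simp)
  also have "fact (2 * 2) / ((2 / ?\<sigma>\<^sup>2) ^ 2 * fact 2) = 3 * (v - u)\<^sup>2"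
    using uv by (simp add: fact_numeral power_divide)
  finally show ?thesis .
qed

lemma brownian_sup_dominated:
  assumes B: "standard_brownian_motion B" and t: "0 \<le> t" and T: "0 < T"
  obtains D where "integrable M D" "AE \<omega> in M. \<forall>s\<in>{0..T}. \<bar>B (t + s) \<omega> - B t \<omega>\<bar> \<le> D \<omega>"
proof -
  \<comment> \<open>In expectation level n contributes \<open>\<epsilon> n\<close> plus 2^n * 3 (T /
    2^n)^2 divided by the cube of \<open>\<epsilon> n\<close>. With ratio 9/10 the latter is 3 T^2
    times the n-th power of 1 / (2 (9/10)^3) = 500/729, so both series converge; any ratio strictly
    between 2^(-1/3) and 1 would do.\<close>
  define \<epsilon> where "\<epsilon> n = (9 / 10 :: real) ^ n" for n
  have \<epsilon>: "0 < \<epsilon> n" for n by (simp add: \<epsilon>_def)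
  define \<Delta> where "\<Delta> n k \<omega> = B (t + real (Suc k) * T / 2 ^ n) \<omega> - B (t + real k * T / 2 ^ n) \<omega>" for n k \<omega>
  define u where "u n \<omega> = \<epsilon> n + (\<Sum>k<2^n. \<Delta> n k \<omega> ^ 4) / \<epsilon> n ^ 3" for n \<omega>
  have grid: "0 \<le> t + real k * T / 2 ^ n" "t + real k * T / 2 ^ n < t + real (Suc k) * T / 2 ^ n" for k n
    using t T by (auto simp: divide_strict_right_mono)
  have [measurable]: "random_variable borel (\<Delta> n k)" for n k
    unfolding \<Delta>_def[abs_def] using brownian_measurable[OF B] grid(1)[of k n] grid(1)[of "Suc k" n]
    by (intro borel_measurable_diff) auto
  have u_nonneg: "0 \<le> u n \<omega>" for n \<omega>
    unfolding u_def using \<epsilon>[of n] by (intro add_nonneg_nonneg divide_nonneg_nonneg sum_nonneg) auto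
  have [measurable]: "random_variable borel (u n)" for n
    unfolding u_def[abs_def] by measurable
  have int_u: "(\<integral>\<^sup>+\<omega>. ennreal (u n \<omega>) \<partial>M) = ennreal ((9 / 10) ^ n + 3 * T\<^sup>2 * (500 / 729) ^ n)" for n
  proof -
    have step: "(t + real (Suc k) * T / 2 ^ n) - (t + real k * T / 2 ^ n) = T / 2 ^ n" for k
      by (simp add: add_divide_distrib algebra_simps)
    have "(\<integral>\<^sup>+\<omega>. ennreal (u n \<omega>) \<partial>M)
        = (\<integral>\<^sup>+\<omega>. ennreal (\<epsilon> n) + ennreal (1 / \<epsilon> n ^ 3) * (\<Sum>k<2^n. ennreal (\<Delta> n k \<omega> ^ 4)) \<partial>M)"
      using \<epsilon>[of n] by (intro nn_integral_cong)
        (simp add: u_def sum_nonneg divide_nonneg_nonneg flip: ennreal_plus ennreal_mult)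
    also have "\<dots> = ennreal (\<epsilon> n) + ennreal (1 / \<epsilon> n ^ 3) * (\<Sum>k<2^n. \<integral>\<^sup>+\<omega>. ennreal (\<Delta> n k \<omega> ^ 4) \<partial>M)"
      by (simp add: nn_integral_add nn_integral_cmult nn_integral_sum emeasure_space_1 del: sum_ennreal)
    also have "(\<Sum>k<2^n. \<integral>\<^sup>+\<omega>. ennreal (\<Delta> n k \<omega> ^ 4) \<partial>M) = (\<Sum>k<(2::nat)^n. ennreal (3 * (T / 2 ^ n)\<^sup>2))"
      unfolding \<Delta>_def nn_integral_brownian_increment_fourth_power[OF B grid] step ..
    also have "\<dots> = ennreal (2 ^ n * (3 * (T / 2 ^ n)\<^sup>2))"
      by (simp add: ennreal_of_nat_eq_real_of_nat flip: ennreal_mult)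
    also have "ennreal (\<epsilon> n) + ennreal (1 / \<epsilon> n ^ 3) * \<dots>
        = ennreal (\<epsilon> n + 1 / \<epsilon> n ^ 3 * (2 ^ n * (3 * (T / 2 ^ n)\<^sup>2)))"
      using \<epsilon>[of n] by (simp flip: ennreal_plus ennreal_mult)
    also have "1 / \<epsilon> n ^ 3 * (2 ^ n * (3 * (T / 2 ^ n)\<^sup>2)) = 3 * T\<^sup>2 * (500 / 729) ^ n"
    proof -
      have "(500 / 729 :: real) ^ n = 1 / ((9 / 10) ^ 3) ^ n * (1 / 2) ^ n"
        by (simp add: power_mult_distrib[symmetric] power_one_over[symmetric] power_divide[symmetric]
          eval_nat_numeral)
      also have "\<dots> = 1 / \<epsilon> n ^ 3 * (1 / 2 ^ n)"
        by (simp add: \<epsilon>_def power_one_over mult.commute flip: power_mult)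
      finally show ?thesis by (simp add: power2_eq_square)
    qed
    finally show ?thesis by (simp only: \<epsilon>_def)
  qed
  \<comment> \<open>Formed in \<open>ennreal\<close>, the sum always exists. Its finite expectation
    makes it finite almost everywhere, so \<open>enn2real\<close> changes it on a null set
    only.\<close>
  define D' where "D' \<omega> = (\<Sum>n. ennreal (u n \<omega>))" for \<omega>
  have [measurable]: "D' \<in> borel_measurable M" unfolding D'_def[abs_def] by measurable
  have "(\<integral>\<^sup>+\<omega>. D' \<omega> \<partial>M) = (\<Sum>n. ennreal ((9 / 10) ^ n + 3 * T\<^sup>2 * (500 / 729) ^ n))"
    unfolding D'_def by (subst nn_integral_suminf) (auto simp: int_u)
  also have "\<dots> < \<infinity>"
  proof -
    have "summable (\<lambda>n. (9 / 10) ^ n + 3 * T\<^sup>2 * (500 / 729 :: real) ^ n)"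
      by (intro summable_add summable_mult summable_geometric) auto
    then show ?thesis
      by (subst suminf_ennreal2) auto
  qed
  finally have finite: "(\<integral>\<^sup>+\<omega>. D' \<omega> \<partial>M) < \<infinity>" .
  then have "AE \<omega> in M. D' \<omega> \<noteq> \<infinity>"
    by (intro nn_integral_noteq_infinite) auto
  moreover note brownian_continuous[OF B]
  ultimately have bound: "AE \<omega> in M. \<forall>s\<in>{0..T}. \<bar>B (t + s) \<omega> - B t \<omega>\<bar> \<le> enn2real (D' \<omega>)"
  proof eventually_elim
    case (elim \<omega>)
    let ?f = "\<lambda>s. B (t + s) \<omega> - B t \<omega>"
    show ?case
    proof
      fix s assume "s \<in> {0..T}"
      show "\<bar>?f s\<bar> \<le> enn2real (D' \<omega>)"
      proof (rule dyadic_chaining_continuous[of ?f "\<lambda>n. u n \<omega>" T])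
        show "continuous_on {0..T} ?f"
          using t by (intro continuous_intros continuous_on_compose2[OF elim(2)]) auto
        show "(\<Sum>m\<le>n. u m \<omega>) \<le> enn2real (D' \<omega>)" for n
        proof -
          have "ennreal (\<Sum>m\<le>n. u m \<omega>) = (\<Sum>m\<in>{..n}. ennreal (u m \<omega>))"
            by (simp add: u_nonneg)
          also have "\<dots> \<le> D' \<omega>"
            unfolding D'_def by (rule sum_le_suminf) auto
          also have "\<dots> = ennreal (enn2real (D' \<omega>))"
            using elim(1) by (simp add: less_top)
          finally show ?thesis by (simp add: ennreal_le_iff)
        qed
        show "\<bar>?f (real (Suc k) * T / 2 ^ n) - ?f (real k * T / 2 ^ n)\<bar> \<le> u n \<omega>" if "k < 2 ^ n" for n k
        proof -
          have "\<bar>\<Delta> n k \<omega>\<bar> \<le> \<epsilon> n + \<Delta> n k \<omega> ^ 4 / \<epsilon> n ^ 3"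
            by (rule abs_le_threshold_plus_fourth_power[OF \<epsilon>])
          also have "\<dots> \<le> u n \<omega>"
            unfolding u_def using that \<epsilon>[of n]
            by (intro add_left_mono divide_right_mono member_le_sum) auto
          finally show ?thesis by (simp add: \<Delta>_def)
        qed
      qed (use T u_nonneg \<open>s \<in> {0..T}\<close> in auto)
    qed
  qed
  have "integrable M (\<lambda>\<omega>. enn2real (D' \<omega>))"
  proof (rule integrableI_bounded)
    have "(\<integral>\<^sup>+\<omega>. ennreal (norm (enn2real (D' \<omega>))) \<partial>M) \<le> (\<integral>\<^sup>+\<omega>. D' \<omega> \<partial>M)"
      by (rule nn_integral_mono) (auto simp: ennreal_enn2real_if)
    then show "(\<integral>\<^sup>+\<omega>. ennreal (norm (enn2real (D' \<omega>))) \<partial>M) < \<infinity>"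
      using finite by (rule le_less_trans)
  qed measurable
  then show thesis
    using bound by (rule that)
qed

end

section \<open>Optional stopping for the observed process\<close>

text \<open>Rounding up makes j smaller than the index exactly if the j-th grid point lies strictly
  before s. Whether cell j is used is thus decided at its left end, as a non-anticipating sum
  requires.\<close>

definition grid_index :: "real \<Rightarrow> nat \<Rightarrow> real \<Rightarrow> nat" where
  "grid_index S n s = nat \<lceil>s * real (Suc n) / S\<rceil>"

lemma grid_index_le:
  assumes "0 < S" "s \<le> S"
  shows "grid_index S n s \<le> Suc n"
proof -
  have "s * real (Suc n) \<le> S * real (Suc n)" using assms by (intro mult_right_mono) auto
  then have "s * real (Suc n) / S \<le> real_of_int (int (Suc n))"
    using assms by (simp add: pos_divide_le_eq mult.commute)
  then show ?thesis
    unfolding grid_index_def by (simp only: nat_le_iff ceiling_le_iff)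
qed

lemma less_grid_index_iff:
  assumes "0 < S"
  shows "j < grid_index S n s \<longleftrightarrow> real j * S / real (Suc n) < s"
proof -
  have "j < grid_index S n s \<longleftrightarrow> real j < s * real (Suc n) / S"
    unfolding grid_index_def by linarith
  also have "\<dots> \<longleftrightarrow> real j * S / real (Suc n) < s"
    using assms by (simp add: pos_divide_less_eq pos_less_divide_eq)
  finally show ?thesis .
qed

lemma tendsto_grid_index:
  assumes "0 < S" "0 \<le> s"
  shows "(\<lambda>n. real (grid_index S n s) * S / real (Suc n)) \<longlonglongrightarrow> s"
proof -
  have upper: "real (grid_index S n s) * S / real (Suc n) \<le> s + S / real (Suc n)" for n
  proof -
    have "0 \<le> s * real (Suc n) / S" using assms by simp
    then have "real (grid_index S n s) \<le> s * real (Suc n) / S + 1"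
      unfolding grid_index_def by linarith
    then have "real (grid_index S n s) * S / real (Suc n) \<le> (s * real (Suc n) / S + 1) * S / real (Suc n)"
      using assms by (intro divide_right_mono mult_right_mono) auto
    also have "\<dots> = s + S / real (Suc n)"
      using assms by (simp add: distrib_right add_divide_distrib del: of_nat_Suc)
    finally show ?thesis .
  qed
  have lower: "s \<le> real (grid_index S n s) * S / real (Suc n)" for n
    using less_grid_index_iff[OF assms(1), of "grid_index S n s" n s] by simp
  have "(\<lambda>n. s + S / real (Suc n)) \<longlonglongrightarrow> s + 0"
    by (intro tendsto_add tendsto_const lim_const_over_n[THEN LIMSEQ_Suc])
  then have "(\<lambda>n. s + S / real (Suc n)) \<longlonglongrightarrow> s" by simp
  from tendsto_sandwich[OF always_eventually[OF allI[OF lower]] always_eventually[OF allI[OF upper]] tendsto_const this]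
  show ?thesis .
qed

context embedded_problem
begin

lemma \<theta>_event: "C \<in> sets borel \<Longrightarrow> {\<omega> \<in> space M. \<theta> \<omega> \<in> C} \<in> sets (vimage_algebra (space M) \<theta> borel)"
  using in_vimage_algebra[of C borel \<theta> "space M"] by (simp add: vimage_def Int_def conj_commute)

lemma subalgebra_\<theta>: "subalgebra M (vimage_algebra (space M) \<theta> borel)"
  by (rule subalgebra_vimage_algebra[OF rv_\<theta>])

lemma brownian_path_continuous:
  assumes "0 \<le> t"
  shows "AE \<omega> in M. continuous_on {0..} (\<lambda>s. B (t + s) \<omega> - B t \<omega>)"
  using brownian_continuous[OF brownian]
proof eventually_elim
  case (elim \<omega>)
  show ?case
    using assms by (intro continuous_intros continuous_on_compose2[OF elim]) auto
qed

text \<open>For s beyond 1 - t the filtration involves X after time 1, of which nothing is assumed;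
  but then the event is the whole space, because \<tau> is bounded by 1 - t.\<close>

lemma stopping_time_measurable:
  assumes \<tau>: "stopping_time (observation_filtration M t X) \<tau>"
    and range: "\<And>\<omega>. \<omega> \<in> space M \<Longrightarrow> \<tau> \<omega> \<le> S" and S: "S \<le> 1 - t"
  shows "random_variable borel \<tau>"
proof (rule borel_measurableI_le)
  fix s
  show "{\<omega> \<in> space M. \<tau> \<omega> \<le> s} \<in> events"
  proof (cases "s \<le> 1 - t")
    case True
    have "subalgebra M (observation_filtration M t X s)"
      unfolding observation_filtration_def
      by (rule subalgebra_generated) (use True in \<open>auto intro!: rv_X\<close>)
    moreover have "{\<omega> \<in> space M. \<tau> \<omega> \<le> s} \<in> sets (observation_filtration M t X s)"
      using stopping_timeD[OF \<tau>, of s] by (simp add: pred_def observation_filtration_def)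
    ultimately show ?thesis by (auto simp: subalgebra_def)
  next
    case False
    then have "{\<omega> \<in> space M. \<tau> \<omega> \<le> s} = space M" using range S by fastforce
    then show ?thesis by simp
  qed
qed

text \<open>With \<tau> rounded to a grid, the evaluation is a countable case distinction. As every
  path is continuous, these approximations converge at every point of the space, so no completion is
  involved.\<close>

lemma stopped_measurable:
  assumes t: "t < 1" and \<tau>: "random_variable borel \<tau>"
    and range: "\<And>\<omega>. \<omega> \<in> space M \<Longrightarrow> 0 \<le> \<tau> \<omega> \<and> \<tau> \<omega> \<le> 1 - t"
  shows "random_variable borel (\<lambda>\<omega>. X (t + \<tau> \<omega>) \<omega>)"
proof (rule borel_measurable_LIMSEQ_real)
  \<comment> \<open>The cap by 1 - t keeps the argument in [t, 1] for every index k, not only for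
    those that occur: each branch of the countable composition has to be measurable.\<close>
  define r where "r n k = min (real k * (1 - t) / real (Suc n)) (1 - t)" for n k
  let ?k = "\<lambda>n \<omega>. grid_index (1 - t) n (\<tau> \<omega>)"
  show "random_variable borel (\<lambda>\<omega>. X (t + r n (?k n \<omega>)) \<omega>)" for n
  proof (rule measurable_compose_countable[where f = "\<lambda>k. X (t + r n k)" and g = "?k n"])
    show "random_variable borel (X (t + r n k))" for k
      using t by (intro rv_X) (auto simp: r_def)
    show "?k n \<in> measurable M (count_space UNIV)"
      unfolding grid_index_def using \<tau> by measurable
  qed
  fix \<omega> assume \<omega>: "\<omega> \<in> space M"
  have "(\<lambda>n. min (real (?k n \<omega>) * (1 - t) / real (Suc n)) (1 - t)) \<longlonglongrightarrow> min (\<tau> \<omega>) (1 - t)"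
    using range[OF \<omega>] t by (intro tendsto_min tendsto_grid_index tendsto_const) auto
  then have lim: "(\<lambda>n. t + r n (?k n \<omega>)) \<longlonglongrightarrow> t + \<tau> \<omega>"
    using range[OF \<omega>] unfolding r_def by (intro tendsto_add tendsto_const) simp
  have "t + r n k \<in> {t..1}" for n k
    using t by (auto simp: r_def)
  then show "(\<lambda>n. X (t + r n (?k n \<omega>)) \<omega>) \<longlonglongrightarrow> X (t + \<tau> \<omega>) \<omega>"
    using range[OF \<omega>]
    by (intro continuous_on_tendsto_compose[OF continuous_X[OF \<omega>] lim] always_eventually allI) auto
qed

text \<open>Optional stopping for the exponential supermartingale of the Wiener integral of \<open>w\<close>, written
  by parts, on an event \<open>A\<close> on which the observation is a functional of the noise. The increments
  of \<open>q\<close> dominate those of the quadratic variation.\<close>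

lemma exp_stopped_integral_le:
  fixes w w' q :: "real \<Rightarrow> real"
  fixes L :: "'a \<Rightarrow> real"
  assumes t: "0 \<le> t" and S: "0 < S"
    and A: "A \<in> sets (vimage_algebra (space M) \<theta> borel)"
    and determined: "\<And>s. 0 \<le> s \<Longrightarrow> s < S \<Longrightarrow>
      \<exists>g\<in>borel_measurable (generated M B {0..t + s}). AE \<omega> in M. \<omega> \<in> A \<longrightarrow> X (t + s) \<omega> = g \<omega>"
    and \<tau>: "stopping_time (observation_filtration M t X) \<tau>"
    and range: "\<And>\<omega>. \<omega> \<in> space M \<Longrightarrow> 0 \<le> \<tau> \<omega> \<and> \<tau> \<omega> \<le> S"
    and w_deriv: "\<And>r. r \<in> {0..S} \<Longrightarrow> (w has_real_derivative w' r) (at r within {0..S})"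
    and w'_cont: "continuous_on {0..S} w'" and w'_nonneg: "\<And>r. r \<in> {0..S} \<Longrightarrow> 0 \<le> w' r"
    and q_cont: "continuous_on {0..S} q"
    and q: "\<And>r s. 0 \<le> r \<Longrightarrow> r \<le> s \<Longrightarrow> s \<le> S \<Longrightarrow> (w r)\<^sup>2 * (s - r) \<le> q s - q r"
    and L: "AE \<omega> in M. \<omega> \<in> A \<longrightarrow> L \<omega> = w (\<tau> \<omega>) * (B (t + \<tau> \<omega>) \<omega> - B t \<omega>)
      - integral {0..\<tau> \<omega>} (\<lambda>r. (B (t + r) \<omega> - B t \<omega>) * w' r)"
  shows "(\<integral>\<^sup>+\<omega>. indicator A \<omega> * ennreal (exp (l * L \<omega> - l\<^sup>2 * (q (\<tau> \<omega>) - q 0) / 2)) \<partial>M) \<le> emeasure M A"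
proof -
  define g where "g n j = real j * S / real (Suc n)" for n j
  have g_0: "g n 0 = 0" for n by (simp add: g_def)
  have g_less: "g n j < g n (Suc j)" for n j
    using S by (simp add: g_def divide_strict_right_mono)
  have g_nonneg: "0 \<le> g n j" for n j
    using S by (simp add: g_def)
  have g_le: "g n j \<le> S" if "j \<le> Suc n" for n j
  proof -
    have "real j * S \<le> real (Suc n) * S" using that S by (intro mult_right_mono) auto
    then show ?thesis by (simp add: g_def pos_divide_le_eq mult.commute)
  qed
  have g_less_S: "g n j < S" if "j < Suc n" for n j
    using g_le[of "Suc j" n] g_less[of n j] that by simp
  define k where "k n \<omega> = grid_index S n (\<tau> \<omega>)" for n \<omega>
  have k_le: "k n \<omega> \<le> Suc n" if "\<omega> \<in> space M" for n \<omega>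
    unfolding k_def using range[OF that] S by (intro grid_index_le) auto
  have less_k: "j < k n \<omega> \<longleftrightarrow> g n j < \<tau> \<omega>" for j n \<omega>
    unfolding k_def g_def by (rule less_grid_index_iff[OF S])
  \<comment> \<open>Whether \<tau> lies beyond grid point j is read off the observation up to that
    point; on A this event is replaced, up to a null set, by an event of the past of B.\<close>
  have "\<exists>E\<in>sets (generated M B {0..t + g n j}). AE \<omega> in M. \<omega> \<in> A \<longrightarrow> (\<omega> \<in> E \<longleftrightarrow> j < k n \<omega>)"
    if j: "j < Suc n" for n j
  proof -
    have "{\<omega> \<in> space M. g n j < \<tau> \<omega>} \<in> sets (observation_filtration M t X (g n j))"
      using stopping_timeD2[OF \<tau>, of "g n j"] by (simp add: pred_def observation_filtration_def)
    then have "\<exists>E\<in>sets (generated M B {0..t + g n j}).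
        AE \<omega> in M. \<omega> \<in> A \<longrightarrow> (\<omega> \<in> {\<omega> \<in> space M. g n j < \<tau> \<omega>} \<longleftrightarrow> \<omega> \<in> E)"
      unfolding observation_filtration_def
    proof (rule generated_AE_cong[rotated 2])
      fix r assume r: "r \<in> {0..g n j}"
      then obtain h where h: "h \<in> borel_measurable (generated M B {0..t + r})"
        "AE \<omega> in M. \<omega> \<in> A \<longrightarrow> X (t + r) \<omega> = h \<omega>"
        using determined[of r] g_less_S[OF j] by auto
      have "subalgebra (generated M B {0..t + g n j}) (generated M B {0..t + r})"
        using r by (intro subalgebra_generated_mono) auto
      from measurable_from_subalg[OF this h(1)] h(2)
      show "\<exists>h\<in>borel_measurable (generated M B {0..t + g n j}). AE \<omega> in M. \<omega> \<in> A \<longrightarrow> X (t + r) \<omega> = h \<omega>"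
        by blast
    qed simp
    then obtain E where E: "E \<in> sets (generated M B {0..t + g n j})"
      "AE \<omega> in M. \<omega> \<in> A \<longrightarrow> (\<omega> \<in> {\<omega> \<in> space M. g n j < \<tau> \<omega>} \<longleftrightarrow> \<omega> \<in> E)" by blast
    from E(2) have "AE \<omega> in M. \<omega> \<in> A \<longrightarrow> (\<omega> \<in> E \<longleftrightarrow> j < k n \<omega>)"
      using AE_space by eventually_elim (auto simp: less_k)
    with E(1) show ?thesis by blast
  qed
  then have "\<forall>n j. \<exists>E. j < Suc n \<longrightarrow> E \<in> sets (generated M B {0..t + g n j})
      \<and> (AE \<omega> in M. \<omega> \<in> A \<longrightarrow> (\<omega> \<in> E \<longleftrightarrow> j < k n \<omega>))"
    by blast
  then obtain H where H: "\<forall>n j. j < Suc n \<longrightarrow> H n j \<in> sets (generated M B {0..t + g n j})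
      \<and> (AE \<omega> in M. \<omega> \<in> A \<longrightarrow> (\<omega> \<in> H n j \<longleftrightarrow> j < k n \<omega>))"
    unfolding choice_iff by blast
  define \<xi> where "\<xi> n j \<omega> = B (t + g n (Suc j)) \<omega> - B (t + g n j) \<omega>" for n j \<omega>
  define d where "d n j = l\<^sup>2 * (q (g n (Suc j)) - q (g n j)) / 2" for n j
  \<comment> \<open>Built from \<open>H n j\<close> instead of \<tau>, so that \<open>P n\<close> is
    a functional of B alone on the whole space. It is then independent of A and its integral over A
    factorises, whatever the sets \<open>H n j\<close> are outside A.\<close>
  define P where "P n \<omega> = (\<Prod>j<Suc n. ennreal (exp (indicator (H n j) \<omega> * (l * w (g n j) * \<xi> n j \<omega> - d n j))))" for n \<omega>
  have d: "(l * w (g n j))\<^sup>2 * (t + g n (Suc j) - (t + g n j)) / 2 \<le> d n j" if j: "j < Suc n" for n j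
  proof -
    have "(w (g n j))\<^sup>2 * (g n (Suc j) - g n j) \<le> q (g n (Suc j)) - q (g n j)"
      using j g_nonneg g_less[of n j] g_le by (intro q) auto
    from mult_left_mono[OF this, of "l\<^sup>2 / 2"] show ?thesis
      by (simp add: d_def power_mult_distrib mult_ac)
  qed
  have P: "P n \<in> borel_measurable (generated M B {0..t + g n (Suc n)}) \<and> (\<integral>\<^sup>+\<omega>. P n \<omega> \<partial>M) \<le> 1" for n
  proof -
    have "0 \<le> t + g n 0" using t g_0 by simp
    moreover have "t + g n j < t + g n (Suc j)" for j using g_less by simp
    moreover have "H n j \<in> sets (generated M B {0..t + g n j})" if "j < Suc n" for j
      using H that by blast
    ultimately show ?thesis
      unfolding P_def[abs_def] \<xi>_def
      using nn_integral_switched_exp_le_1[of B "\<lambda>j. t + g n j" "Suc n" "\<lambda>j. l * w (g n j)" "d n" "H n"]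
        brownian d by blast
  qed
  have B_sub: "subalgebra M (generated M B {0..})"
    by (rule subalgebra_brownian[OF brownian]) simp
  have PB: "P n \<in> borel_measurable (generated M B {0..})" for n
    by (rule measurable_from_subalg[OF subalgebra_generated_mono[of "{0..t + g n (Suc n)}"]]) (use P[of n] in auto)
  have A': "A \<in> events" using A subalgebra_\<theta> by (auto simp: subalgebra_def)
  have [measurable]: "P n \<in> borel_measurable M" "A \<in> events" for n
    using measurable_from_subalg[OF B_sub PB] A' by auto
  have AP: "(\<integral>\<^sup>+\<omega>. indicator A \<omega> * P n \<omega> \<partial>M) \<le> emeasure M A" for n
  proof -
    have "(\<integral>\<^sup>+\<omega>. indicator A \<omega> * P n \<omega> \<partial>M) = (\<integral>\<^sup>+\<omega>. indicator A \<omega> \<partial>M) * (\<integral>\<^sup>+\<omega>. P n \<omega> \<partial>M)"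
      by (rule indep_set_nn_integral_mult[OF indep subalgebra_\<theta> B_sub _ PB])
        (use A in \<open>rule borel_measurable_indicator\<close>)
    also have "\<dots> \<le> emeasure M A * 1"
      using P A' by (intro mult_mono) auto
    finally show ?thesis by simp
  qed
  \<comment> \<open>On A the switches reduce to j < k, so \<open>P n\<close> is the exponential of a
    left sum up to the rounded stopping time and converges; off A both sides vanish. Writing the
    limit as a liminf prepares Fatou's lemma, which asks for no domination.\<close>
  have "AE \<omega> in M. \<forall>n. \<forall>j\<in>{..<Suc n}. \<omega> \<in> A \<longrightarrow> (\<omega> \<in> H n j \<longleftrightarrow> j < k n \<omega>)"
    unfolding AE_all_countable by (intro allI AE_finite_allI) (use H in auto)
  moreover note brownian_path_continuous[OF t] L AE_space
  ultimately have "AE \<omega> in M. indicator A \<omega> * ennreal (exp (l * L \<omega> - l\<^sup>2 * (q (\<tau> \<omega>) - q 0) / 2))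
      = liminf (\<lambda>n. indicator A \<omega> * P n \<omega>)"
  proof eventually_elim
    case (elim \<omega>)
    show ?case
    proof (cases "\<omega> \<in> A")
      case True
      note \<omega> = \<open>\<omega> \<in> space M\<close>
      let ?\<beta> = "\<lambda>s. B (t + s) \<omega> - B t \<omega>"
      have PE: "P n \<omega> = ennreal (exp (l * (\<Sum>j<k n \<omega>. w (g n j) * (?\<beta> (g n (Suc j)) - ?\<beta> (g n j)))
          - l\<^sup>2 * (q (g n (k n \<omega>)) - q 0) / 2))" for n
      proof -
        have ind: "indicator (H n j) \<omega> = (if j < k n \<omega> then 1 else 0 :: real)" if "j < Suc n" for j
          using elim(1) that True by (simp add: indicator_def)
        have "P n \<omega> = ennreal (exp (\<Sum>j<Suc n. indicator (H n j) \<omega> * (l * w (g n j) * \<xi> n j \<omega> - d n j)))"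
          unfolding P_def by (subst prod_ennreal) (simp_all only: exp_ge_zero exp_sum finite_lessThan)
        also have "(\<Sum>j<Suc n. indicator (H n j) \<omega> * (l * w (g n j) * \<xi> n j \<omega> - d n j))
            = (\<Sum>j<Suc n. if j < k n \<omega> then l * w (g n j) * \<xi> n j \<omega> - d n j else 0)"
          by (rule sum.cong) (simp_all add: ind)
        also have "\<dots> = (\<Sum>j<k n \<omega>. l * w (g n j) * \<xi> n j \<omega> - d n j)"
          using k_le[OF \<omega>, of n] by (intro sum.mono_neutral_cong_right) auto
        also have "\<dots> = l * (\<Sum>j<k n \<omega>. w (g n j) * (?\<beta> (g n (Suc j)) - ?\<beta> (g n j))) - (\<Sum>j<k n \<omega>. d n j)"
          by (simp add: sum_subtractf sum_distrib_left \<xi>_def mult.assoc)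
        also have "(\<Sum>j<k n \<omega>. d n j) = l\<^sup>2 * (q (g n (k n \<omega>)) - q 0) / 2"
          using sum_lessThan_telescope[of "\<lambda>j. q (g n j)" "k n \<omega>"]
          by (simp add: d_def g_0 flip: sum_divide_distrib sum_distrib_left)
        finally show ?thesis .
      qed
      have k_lim: "(\<lambda>n. g n (k n \<omega>)) \<longlonglongrightarrow> \<tau> \<omega>"
        unfolding g_def k_def using range[OF \<omega>] by (intro tendsto_grid_index[OF S]) simp
      have cont: "continuous_on {0..S} ?\<beta>"
        by (rule continuous_on_subset[OF elim(2)]) auto
      have "(\<lambda>n. \<Sum>j<k n \<omega>. w (g n j) * (?\<beta> (g n (Suc j)) - ?\<beta> (g n j)))
          \<longlonglongrightarrow> w (\<tau> \<omega>) * ?\<beta> (\<tau> \<omega>) - w 0 * ?\<beta> 0 - integral {0..\<tau> \<omega>} (\<lambda>r. ?\<beta> r * w' r)"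
        unfolding g_def
        by (rule tendsto_left_sums_by_parts[OF S w_deriv w'_cont w'_nonneg cont k_le[OF \<omega>]])
          (use k_lim in \<open>simp_all add: g_def\<close>)
      also have "w (\<tau> \<omega>) * ?\<beta> (\<tau> \<omega>) - w 0 * ?\<beta> 0 - integral {0..\<tau> \<omega>} (\<lambda>r. ?\<beta> r * w' r) = L \<omega>"
        using elim(3) True by simp
      finally have sum_lim: "(\<lambda>n. \<Sum>j<k n \<omega>. w (g n j) * (?\<beta> (g n (Suc j)) - ?\<beta> (g n j))) \<longlonglongrightarrow> L \<omega>" .
      have "g n (k n \<omega>) \<in> {0..S}" for n
        using g_nonneg g_le k_le[OF \<omega>] by auto
      then have q_lim: "(\<lambda>n. q (g n (k n \<omega>))) \<longlonglongrightarrow> q (\<tau> \<omega>)"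
        using range[OF \<omega>]
        by (intro continuous_on_tendsto_compose[OF q_cont k_lim] always_eventually allI) auto
      have "(\<lambda>n. P n \<omega>) \<longlonglongrightarrow> ennreal (exp (l * L \<omega> - l\<^sup>2 * (q (\<tau> \<omega>) - q 0) / 2))"
        unfolding PE by (intro tendsto_ennrealI tendsto_intros sum_lim q_lim) simp
      then have "liminf (\<lambda>n. P n \<omega>) = ennreal (exp (l * L \<omega> - l\<^sup>2 * (q (\<tau> \<omega>) - q 0) / 2))"
        by (intro lim_imp_Liminf) auto
      then show ?thesis using True by simp
    qed (simp add: Liminf_const)
  qed
  then have "(\<integral>\<^sup>+\<omega>. indicator A \<omega> * ennreal (exp (l * L \<omega> - l\<^sup>2 * (q (\<tau> \<omega>) - q 0) / 2)) \<partial>M)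
      = (\<integral>\<^sup>+\<omega>. liminf (\<lambda>n. indicator A \<omega> * P n \<omega>) \<partial>M)"
    by (rule nn_integral_cong_AE)
  also have "\<dots> \<le> liminf (\<lambda>n. \<integral>\<^sup>+\<omega>. indicator A \<omega> * P n \<omega> \<partial>M)"
    by (rule nn_integral_liminf) measurable
  also have "\<dots> \<le> liminf (\<lambda>n. emeasure M A)"
    by (intro Liminf_mono always_eventually allI AP)
  also have "\<dots> = emeasure M A" by (simp add: Liminf_const)
  finally show ?thesis .
qed

end

text \<open>The equation for X holds only before time 1; continuity carries inequalities, and by a
  double application identities, over to time 1.\<close>

lemma le_at_right_endpoint:
  fixes f g :: "real \<Rightarrow> real"
  assumes T: "0 < T" and f: "continuous_on {0..T} f" and g: "continuous_on {0..T} g"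
    and le: "\<And>s. 0 \<le> s \<Longrightarrow> s < T \<Longrightarrow> f s \<le> g s"
  shows "f T \<le> g T"
proof -
  define r where "r n = T - T / real (Suc n)" for n
  have "r \<longlonglongrightarrow> T - 0"
    unfolding r_def[abs_def] by (intro tendsto_diff tendsto_const lim_const_over_n[THEN LIMSEQ_Suc])
  then have r_lim: "r \<longlonglongrightarrow> T" by simp
  have r: "0 \<le> r n" "r n < T" for n
    using T by (auto simp: r_def pos_divide_le_eq)
  have lim: "(\<lambda>n. h (r n)) \<longlonglongrightarrow> h T" if "continuous_on {0..T} h" for h :: "real \<Rightarrow> real"
    using r T by (intro continuous_on_tendsto_compose[OF that r_lim] always_eventually allI)
      (auto intro: less_imp_le)
  show ?thesis
    by (rule LIMSEQ_le[OF lim[OF f] lim[OF g]]) (use le r in blast)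
qed

lemma integrable_indicator_mult:
  fixes f :: "'a \<Rightarrow> real"
  assumes "A \<in> sets M" "integrable M f"
  shows "integrable M (\<lambda>\<omega>. indicator A \<omega> * f \<omega>)"
  using integrable_mult_indicator[OF assms] by simp

section \<open>The two hidden scenarios along paths, and the drift case\<close>

context embedded_problem
begin

definition drift_event :: "'a set" where "drift_event = {\<omega> \<in> space M. \<theta> \<omega> = 0}"
definition bridge_event :: "'a set" where "bridge_event = {\<omega> \<in> space M. \<theta> \<omega> = 1}"

lemma hidden_events:
  shows drift_event_vimage: "drift_event \<in> sets (vimage_algebra (space M) \<theta> borel)"
    and bridge_event_vimage: "bridge_event \<in> sets (vimage_algebra (space M) \<theta> borel)"
    and drift_event_measurable [measurable]: "drift_event \<in> events"
    and bridge_event_measurable [measurable]: "bridge_event \<in> events"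
    and prob_drift_event: "prob drift_event = 1 - belief a t x p"
    and prob_bridge_event: "prob bridge_event = belief a t x p"
    and hidden_events_disjoint: "drift_event \<inter> bridge_event = {}"
proof -
  show *: "drift_event \<in> sets (vimage_algebra (space M) \<theta> borel)"
    "bridge_event \<in> sets (vimage_algebra (space M) \<theta> borel)"
    using \<theta>_event[of "{0}"] \<theta>_event[of "{1}"] by (auto simp: drift_event_def bridge_event_def)
  then show "drift_event \<in> events" "bridge_event \<in> events"
    using subalgebra_\<theta> by (auto simp: subalgebra_def)
qed (auto simp: drift_event_def bridge_event_def prob_\<theta>_0 prob_\<theta>_1)

lemma AE_hidden_events: "AE \<omega> in M. \<omega> \<in> drift_event \<or> \<omega> \<in> bridge_event"
proof -
  have "prob (drift_event \<union> bridge_event) = 1"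
    using hidden_events_disjoint
    by (subst finite_measure_Union) (auto simp: prob_drift_event prob_bridge_event)
  from AE_in_set_eq_1[THEN iffD2, OF _ this] show ?thesis by simp
qed

lemma observation_path_continuous:
  assumes "\<omega> \<in> space M"
  shows "continuous_on {0..1 - t} (\<lambda>s. X (t + s) \<omega>)"
  by (rule continuous_on_compose2[OF continuous_X[OF assms]]) (auto intro!: continuous_intros)

lemma drift_path:
  assumes t: "0 \<le> t" "t < 1"
  shows "AE \<omega> in M. \<omega> \<in> drift_event \<longrightarrow>
    (\<forall>s\<in>{0..1 - t}. X (t + s) \<omega> = x + a * s + (B (t + s) \<omega> - B t \<omega>))"
  using sde brownian_path_continuous[OF t(1)]
proof eventually_elim
  case (elim \<omega>)
  show ?case
  proof
    assume \<omega>: "\<omega> \<in> drift_event"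
    let ?g = "\<lambda>s. x + a * s + (B (t + s) \<omega> - B t \<omega>)"
    have eq: "X (t + s) \<omega> = ?g s" if "0 \<le> s" "s < 1 - t" for s
      using elim(1) that \<omega> by (auto simp: drift_event_def mult.commute)
    have X_cont: "continuous_on {0..1 - t} (\<lambda>s. X (t + s) \<omega>)"
      using \<omega> by (intro observation_path_continuous) (simp add: drift_event_def)
    have g_cont: "continuous_on {0..1 - t} ?g"
      by (intro continuous_intros continuous_on_subset[OF elim(2)]) auto
    have endpoint: "X (t + (1 - t)) \<omega> = ?g (1 - t)"
      using le_at_right_endpoint[OF _ X_cont g_cont] le_at_right_endpoint[OF _ g_cont X_cont] eq t
      by (intro antisym) auto
    show "\<forall>s\<in>{0..1 - t}. X (t + s) \<omega> = ?g s"
    proof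
      fix s assume "s \<in> {0..1 - t}"
      with eq[of s] endpoint show "X (t + s) \<omega> = ?g s"
        by (cases "s = 1 - t") auto
    qed
  qed
qed

text \<open>The linear bridge equation solved with y = X - a and T = 1 - t: the right-hand side is
  the start value plus the Wiener integral of 1 / (1 - t - r), written by parts. The formula stops
  short of time 1, where the denominator vanishes.\<close>

lemma bridge_path:
  assumes t: "0 \<le> t" "t < 1"
  shows "AE \<omega> in M. \<omega> \<in> bridge_event \<longrightarrow> (\<forall>s. 0 \<le> s \<longrightarrow> s < 1 - t \<longrightarrow>
    (X (t + s) \<omega> - a) / (1 - t - s) = (x - a) / (1 - t) + (B (t + s) \<omega> - B t \<omega>) / (1 - t - s)
      - integral {0..s} (\<lambda>r. (B (t + r) \<omega> - B t \<omega>) / (1 - t - r)\<^sup>2))"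
  using sde brownian_path_continuous[OF t(1)]
proof eventually_elim
  case (elim \<omega>)
  show ?case
  proof (intro impI allI)
    fix s assume \<omega>: "\<omega> \<in> bridge_event" and s: "0 \<le> s" "s < 1 - t"
    have \<theta>: "\<theta> \<omega> = 1" "\<omega> \<in> space M" using \<omega> by (auto simp: bridge_event_def)
    show "(X (t + s) \<omega> - a) / (1 - t - s) = (x - a) / (1 - t) + (B (t + s) \<omega> - B t \<omega>) / (1 - t - s)
      - integral {0..s} (\<lambda>r. (B (t + r) \<omega> - B t \<omega>) / (1 - t - r)\<^sup>2)"
    proof (rule bridge_equation_solution[OF s])
      show "continuous_on {0..s} (\<lambda>r. X (t + r) \<omega> - a)"
        using s by (intro continuous_intros continuous_on_subset[OF observation_path_continuous[OF \<theta>(2)]]) auto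
      show "continuous_on {0..s} (\<lambda>r. B (t + r) \<omega> - B t \<omega>)"
        by (rule continuous_on_subset[OF elim(2)]) auto
      show "X (t + r) \<omega> - a = x - a + integral {0..r} (\<lambda>u. - (X (t + u) \<omega> - a) / (1 - t - u))
          + (B (t + r) \<omega> - B t \<omega>)" if "r \<in> {0..s}" for r
        using elim(1) that s by (simp add: \<theta>)
    qed simp
  qed
qed

text \<open>The noise supremum controls the path on both events, explicitly for the drift and
  through the solution bound for the bridge. A single integrable majorant then serves all stopping
  times and the later dominated convergence to the horizon.\<close>

lemma observation_dominated:
  assumes t: "0 \<le> t" "t < 1"
  obtains D where "integrable M D" "AE \<omega> in M. \<forall>s\<in>{0..1 - t}. \<bar>X (t + s) \<omega>\<bar> \<le> D \<omega>"
proof -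
  obtain D where D: "integrable M D" "AE \<omega> in M. \<forall>s\<in>{0..1 - t}. \<bar>B (t + s) \<omega> - B t \<omega>\<bar> \<le> D \<omega>"
    using brownian_sup_dominated[OF brownian t(1), of "1 - t"] t by auto
  have "AE \<omega> in M. \<forall>s\<in>{0..1 - t}. \<bar>X (t + s) \<omega>\<bar> \<le> \<bar>x\<bar> + 2 * \<bar>a\<bar> + 2 * D \<omega>"
    using D(2) drift_path[OF t] bridge_path[OF t] brownian_path_continuous[OF t(1)] AE_hidden_events
  proof eventually_elim
    case (elim \<omega>)
    have D_nonneg: "0 \<le> D \<omega>" using bspec[OF elim(1), of 0] t by simp
    show ?case
    proof (cases "\<omega> \<in> drift_event")
      case True
      show ?thesis
      proof
        fix s assume s: "s \<in> {0..1 - t}"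
        have "\<bar>a * s\<bar> \<le> \<bar>a\<bar> * 1"
          unfolding abs_mult using s t by (intro mult_left_mono) auto
        moreover have "\<bar>B (t + s) \<omega> - B t \<omega>\<bar> \<le> D \<omega>"
          using elim(1) s by (rule bspec)
        moreover have "X (t + s) \<omega> = x + a * s + (B (t + s) \<omega> - B t \<omega>)"
          using elim(2) True s by blast
        ultimately show "\<bar>X (t + s) \<omega>\<bar> \<le> \<bar>x\<bar> + 2 * \<bar>a\<bar> + 2 * D \<omega>"
          using D_nonneg by linarith
      qed
    next
      case False
      with elim(5) have bridge: "\<omega> \<in> bridge_event" by blast
      then have \<omega>: "\<omega> \<in> space M" by (simp add: bridge_event_def)
      have le: "\<bar>X (t + s) \<omega>\<bar> \<le> \<bar>x\<bar> + 2 * \<bar>a\<bar> + 2 * D \<omega>" if s: "0 \<le> s" "s < 1 - t" for s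
      proof -
        have "\<bar>X (t + s) \<omega> - a\<bar> \<le> \<bar>x - a\<bar> + 2 * D \<omega>"
        proof (rule bridge_solution_bound[OF s])
          show "continuous_on {0..s} (\<lambda>r. B (t + r) \<omega> - B t \<omega>)"
            by (rule continuous_on_subset[OF elim(4)]) auto
          show "(X (t + s) \<omega> - a) / (1 - t - s) = (x - a) / (1 - t) + (B (t + s) \<omega> - B t \<omega>) / (1 - t - s)
              - integral {0..s} (\<lambda>r. (B (t + r) \<omega> - B t \<omega>) / (1 - t - r)\<^sup>2)"
            using elim(3) bridge s by blast
          show "\<bar>B (t + r) \<omega> - B t \<omega>\<bar> \<le> D \<omega>" if "r \<in> {0..s}" for r
            by (rule bspec[OF elim(1)]) (use that s in auto)
        qed
        then show ?thesis by linarith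
      qed
      have endpoint: "\<bar>X (t + (1 - t)) \<omega>\<bar> \<le> \<bar>x\<bar> + 2 * \<bar>a\<bar> + 2 * D \<omega>"
        by (rule le_at_right_endpoint[of "1 - t" "\<lambda>s. \<bar>X (t + s) \<omega>\<bar>" "\<lambda>_. \<bar>x\<bar> + 2 * \<bar>a\<bar> + 2 * D \<omega>"])
          (use t le in \<open>auto intro!: continuous_on_rabs continuous_on_const observation_path_continuous[OF \<omega>]\<close>)
      show ?thesis
      proof
        fix s assume "s \<in> {0..1 - t}"
        with le[of s] endpoint show "\<bar>X (t + s) \<omega>\<bar> \<le> \<bar>x\<bar> + 2 * \<bar>a\<bar> + 2 * D \<omega>"
          by (cases "s = 1 - t") auto
      qed
    qed
  qed
  then show thesis
    by (rule that[rotated]) (use D(1) in auto)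
qed

text \<open>The Bochner integral of a non-integrable function is 0 by convention; integrability
  gives the expectations their usual meaning and allows splitting them over the two events.\<close>

lemma stopped_integrable:
  assumes t: "0 \<le> t" "t < 1" and \<tau>: "random_variable borel \<tau>"
    and range: "\<And>\<omega>. \<omega> \<in> space M \<Longrightarrow> 0 \<le> \<tau> \<omega> \<and> \<tau> \<omega> \<le> 1 - t"
  shows "integrable M (\<lambda>\<omega>. X (t + \<tau> \<omega>) \<omega>)"
proof -
  obtain D where D: "integrable M D" "AE \<omega> in M. \<forall>s\<in>{0..1 - t}. \<bar>X (t + s) \<omega>\<bar> \<le> D \<omega>"
    by (rule observation_dominated[OF t])
  show ?thesis
  proof (rule Bochner_Integration.integrable_bound[OF D(1) stopped_measurable[OF t(2) \<tau> range]])
    show "AE \<omega> in M. norm (X (t + \<tau> \<omega>) \<omega>) \<le> norm (D \<omega>)"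
      using D(2) AE_space
    proof eventually_elim
      case (elim \<omega>)
      with range[of \<omega>] have "\<bar>X (t + \<tau> \<omega>) \<omega>\<bar> \<le> D \<omega>" by simp
      then show ?case by simp
    qed
  qed
qed

text \<open>The bound for the exponential supermartingale and \<open>1 + y \<le> exp y\<close> give
  \<open>l * E[\<beta>; \<theta> = 0] \<le> l\<^sup>2 / 2\<close> for the stopped noise \<open>\<beta>\<close>; now let \<open>l\<close> tend to \<open>0\<close>.\<close>

lemma drift_stopped_le:
  assumes t: "0 \<le> t" "t < 1" and \<tau>: "stopping_time (observation_filtration M t X) \<tau>"
    and range: "\<And>\<omega>. \<omega> \<in> space M \<Longrightarrow> 0 \<le> \<tau> \<omega> \<and> \<tau> \<omega> \<le> 1 - t"
  shows "(\<integral>\<omega>. indicator drift_event \<omega> * X (t + \<tau> \<omega>) \<omega> \<partial>M) \<le> prob drift_event * (x + max a 0)"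
proof -
  let ?A = drift_event
  have A_int: "integrable M (indicator ?A :: 'a \<Rightarrow> real)"
    by (rule integrable_real_indicator) (auto simp: emeasure_eq_measure)
  have \<tau>_meas [measurable]: "random_variable borel \<tau>"
    by (rule stopping_time_measurable[OF \<tau>, of "1 - t"]) (use range in auto)
  have X_int: "integrable M (\<lambda>\<omega>. X (t + \<tau> \<omega>) \<omega>)"
    by (rule stopped_integrable[OF t \<tau>_meas range])
  note [measurable] = borel_measurable_integrable[OF X_int]
  have \<tau>_int: "integrable M \<tau>"
    by (rule integrable_const_bound[of _ "1 - t"]) (use range AE_space in \<open>auto elim!: eventually_mono\<close>)
  define L where "L \<omega> = X (t + \<tau> \<omega>) \<omega> - x - a * \<tau> \<omega>" for \<omega>
  have L_int: "integrable M L"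
    unfolding L_def[abs_def] using X_int \<tau>_int by auto
  note [measurable] = borel_measurable_integrable[OF L_int]
  have AL_int: "integrable M (\<lambda>\<omega>. indicator ?A \<omega> * L \<omega>)"
    by (rule integrable_indicator_mult[OF drift_event_measurable L_int])
  \<comment> \<open>For w = 1 the Wiener integral is the noise increment itself, the term with w'
    vanishes, and the quadratic variation is q s = s.\<close>
  have exp_le: "(\<integral>\<^sup>+\<omega>. indicator ?A \<omega> * ennreal (exp (l * L \<omega> - l\<^sup>2 * (\<tau> \<omega> - 0) / 2)) \<partial>M) \<le> emeasure M ?A" for l
  proof (rule exp_stopped_integral_le[OF t(1) _ drift_event_vimage _ \<tau> range,
      where w = "\<lambda>_. 1" and w' = "\<lambda>_. 0" and q = "\<lambda>s. s"])
    show "AE \<omega> in M. \<omega> \<in> ?A \<longrightarrow> L \<omega> = 1 * (B (t + \<tau> \<omega>) \<omega> - B t \<omega>)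
        - integral {0..\<tau> \<omega>} (\<lambda>r. (B (t + r) \<omega> - B t \<omega>) * 0)"
      using drift_path[OF t] AE_space
      by eventually_elim (use range in \<open>auto simp: L_def\<close>)
    fix s assume s: "0 \<le> s" "s < 1 - t"
    show "\<exists>g\<in>borel_measurable (generated M B {0..t + s}). AE \<omega> in M. \<omega> \<in> ?A \<longrightarrow> X (t + s) \<omega> = g \<omega>"
    proof
      have "B (t + s) \<in> borel_measurable (generated M B {0..t + s})"
        "B t \<in> borel_measurable (generated M B {0..t + s})"
        using s t by (auto intro!: measurable_generated)
      then show "(\<lambda>\<omega>. x + a * s + (B (t + s) \<omega> - B t \<omega>)) \<in> borel_measurable (generated M B {0..t + s})"
        by measurable
      show "AE \<omega> in M. \<omega> \<in> ?A \<longrightarrow> X (t + s) \<omega> = x + a * s + (B (t + s) \<omega> - B t \<omega>)"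
        using drift_path[OF t] by eventually_elim (use s in auto)
    qed
  qed (use t in \<open>auto intro!: continuous_intros\<close>)
  have AL_le: "(\<integral>\<omega>. indicator ?A \<omega> * L \<omega> \<partial>M) \<le> l" if "0 < l" for l
  proof -
    define F where "F \<omega> = indicator ?A \<omega> * exp (l * L \<omega> - l\<^sup>2 * \<tau> \<omega> / 2)" for \<omega>
    have F_nonneg: "0 \<le> F \<omega>" for \<omega> by (simp add: F_def)
    have [measurable]: "random_variable borel F" unfolding F_def[abs_def] by measurable
    have nn_F: "(\<integral>\<^sup>+\<omega>. ennreal (F \<omega>) \<partial>M) \<le> ennreal (prob ?A)"
    proof -
      have "(\<integral>\<^sup>+\<omega>. ennreal (F \<omega>) \<partial>M)
          = (\<integral>\<^sup>+\<omega>. indicator ?A \<omega> * ennreal (exp (l * L \<omega> - l\<^sup>2 * (\<tau> \<omega> - 0) / 2)) \<partial>M)"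
        by (rule nn_integral_cong) (simp add: F_def indicator_def)
      with exp_le[of l] show ?thesis by (simp add: emeasure_eq_measure)
    qed
    have F_int: "integrable M F"
      by (rule integrableI_nonneg) (use nn_F F_nonneg in \<open>auto intro: le_less_trans\<close>)
    have "(\<integral>\<omega>. F \<omega> \<partial>M) \<le> prob ?A"
      using nn_F nn_integral_eq_integral[OF F_int] F_nonneg by (simp add: ennreal_le_iff)
    moreover have "(\<integral>\<omega>. indicator ?A \<omega> + (l * (indicator ?A \<omega> * L \<omega>) - l\<^sup>2 / 2) \<partial>M) \<le> (\<integral>\<omega>. F \<omega> \<partial>M)"
    proof (rule integral_mono[OF _ F_int])
      show "integrable M (\<lambda>\<omega>. indicator ?A \<omega> + (l * (indicator ?A \<omega> * L \<omega>) - l\<^sup>2 / 2))"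
        using AL_int A_int by simp
      fix \<omega> assume "\<omega> \<in> space M"
      then have "l\<^sup>2 * \<tau> \<omega> / 2 \<le> l\<^sup>2 * 1 / 2"
        using range[of \<omega>] t by (intro divide_right_mono mult_left_mono) auto
      moreover have "1 + (l * L \<omega> - l\<^sup>2 * \<tau> \<omega> / 2) \<le> exp (l * L \<omega> - l\<^sup>2 * \<tau> \<omega> / 2)"
        by (rule exp_ge_add_one_self)
      ultimately have "1 + (l * L \<omega> - l\<^sup>2 / 2) \<le> exp (l * L \<omega> - l\<^sup>2 * \<tau> \<omega> / 2)"
        by linarith
      then show "indicator ?A \<omega> + (l * (indicator ?A \<omega> * L \<omega>) - l\<^sup>2 / 2) \<le> F \<omega>"
        by (auto simp: F_def indicator_def)
    qed
    moreover have "(\<integral>\<omega>. indicator ?A \<omega> + (l * (indicator ?A \<omega> * L \<omega>) - l\<^sup>2 / 2) \<partial>M)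
        = prob ?A + (l * (\<integral>\<omega>. indicator ?A \<omega> * L \<omega> \<partial>M) - l\<^sup>2 / 2)"
      using AL_int A_int by (simp add: prob_space)
    ultimately have "l * (\<integral>\<omega>. indicator ?A \<omega> * L \<omega> \<partial>M) \<le> l * (l / 2)"
      by (simp add: power2_eq_square)
    then have "(\<integral>\<omega>. indicator ?A \<omega> * L \<omega> \<partial>M) \<le> l / 2"
      using that by (simp only: mult_le_cancel_left_pos)
    then show ?thesis using that by linarith
  qed
  have AL: "(\<integral>\<omega>. indicator ?A \<omega> * L \<omega> \<partial>M) \<le> 0"
    by (rule field_le_epsilon) (simp add: AL_le)
  have "(\<integral>\<omega>. indicator ?A \<omega> * X (t + \<tau> \<omega>) \<omega> \<partial>M)
      \<le> (\<integral>\<omega>. indicator ?A \<omega> * (x + max a 0) + indicator ?A \<omega> * L \<omega> \<partial>M)"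
  proof (rule integral_mono)
    show "integrable M (\<lambda>\<omega>. indicator ?A \<omega> * X (t + \<tau> \<omega>) \<omega>)"
      by (rule integrable_indicator_mult[OF drift_event_measurable X_int])
    show "integrable M (\<lambda>\<omega>. indicator ?A \<omega> * (x + max a 0) + indicator ?A \<omega> * L \<omega>)"
      using AL_int A_int by simp
    fix \<omega> assume "\<omega> \<in> space M"
    then have "a * \<tau> \<omega> \<le> max a 0 * 1"
      using range[of \<omega>] t by (intro mult_mono) auto
    then show "indicator ?A \<omega> * X (t + \<tau> \<omega>) \<omega> \<le> indicator ?A \<omega> * (x + max a 0) + indicator ?A \<omega> * L \<omega>"
      by (auto simp: L_def indicator_def)
  qed
  also have "\<dots> = prob ?A * (x + max a 0) + (\<integral>\<omega>. indicator ?A \<omega> * L \<omega> \<partial>M)"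
    using AL_int A_int by simp
  finally show ?thesis using AL by simp
qed

end

section \<open>The known-pinning value as an exponential mixture, and the bridge case\<close>

text \<open>Here \<open>v\<close> is the remaining time \<open>1 - t\<close> and \<open>m\<close> stands for \<open>(x - a) / v\<close>, which is a martingale
  along the bridge; below the boundary \<open>V\<^sub>1 = a + pinned_gain v m\<close>.\<close>

definition pinned_gain :: "real \<Rightarrow> real \<Rightarrow> real" where
  "pinned_gain v m = (1 - boundary_const\<^sup>2)
     * (sqrt (2 * pi * v) * exp (m\<^sup>2 * v / 2) * std_normal_cdf (m * sqrt v))"

lemma pinned_gain_nonneg: "0 \<le> v \<Longrightarrow> 0 \<le> pinned_gain v m"
  using one_minus_boundary_const_sq_pos std_normal_cdf_nonneg by (simp add: pinned_gain_def)

text \<open>The mixture at clock \<sigma> = 1 / v. In this form the expectation can be exchanged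
  with the integral over l, which reduces the bound to single exponentials.\<close>

lemma pinned_gain_eq_nn_integral:
  assumes "0 < v"
  shows "ennreal (pinned_gain v m) = ennreal (1 - boundary_const\<^sup>2)
    * (\<integral>\<^sup>+l. ennreal (exp (l * m - l\<^sup>2 * (1 / v) / 2)) * indicator {0..} l \<partial>lborel)"
  using assms one_minus_boundary_const_sq_pos nn_integral_exp_mixture[of "1 / v" m]
  by (simp add: pinned_gain_def real_sqrt_divide flip: ennreal_mult' std_normal_cdf_nonneg)

text \<open>Brownian scaling of the tangency inequality: take z = m * sqrt v and multiply by sqrt v.
  The left-hand side is the reward x - a.\<close>

lemma le_pinned_gain_scaled:
  assumes "0 < v"
  shows "v * m \<le> pinned_gain v m"
proof -
  have "sqrt v * (m * sqrt v) \<le> sqrt v * ((1 - boundary_const\<^sup>2)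
      * (sqrt (2 * pi) * exp ((m * sqrt v)\<^sup>2 / 2) * std_normal_cdf (m * sqrt v)))"
    using assms by (intro mult_left_mono le_pinned_gain) auto
  also have "\<dots> = pinned_gain v m"
    using assms by (simp add: pinned_gain_def power_mult_distrib real_sqrt_mult mult_ac)
  also have "sqrt v * (m * sqrt v) = v * m"
    using assms by (simp add: mult.left_commute)
  finally show ?thesis .
qed

text \<open>The point of tangency z = \<alpha> in scaled form: the defining equation of \<alpha>
  makes gain and reward equal on the boundary.\<close>

lemma pinned_gain_boundary:
  assumes "0 < v"
  shows "pinned_gain v (boundary_const / sqrt v) = boundary_const * sqrt v"
proof -
  have "pinned_gain v (boundary_const / sqrt v) = sqrt v * (sqrt (2 * pi) * (1 - boundary_const\<^sup>2)
      * exp (boundary_const\<^sup>2 / 2) * std_normal_cdf boundary_const)"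
    using assms by (simp add: pinned_gain_def power_divide real_sqrt_mult mult_ac)
  also have "\<dots> = boundary_const * sqrt v"
    by (subst boundary_const_eq) (rule mult.commute)
  finally show ?thesis .
qed

context embedded_problem
begin

text \<open>Lowering the start of the bridge by \<open>\<delta>\<close> lowers its value at time \<open>t + s\<close> by
  \<open>\<delta> * (1 - t - s) / (1 - t) \<le> \<delta>\<close>. Starts above the boundary are reduced in this way to a start on it,
  so that no supermartingale property is needed in the stopping region.\<close>

lemma bridge_stopped_le_before:
  assumes t: "0 \<le> t" and S: "0 < S" "S < 1 - t" and \<delta>: "0 \<le> \<delta>"
    and \<tau>: "stopping_time (observation_filtration M t X) \<tau>"
    and range: "\<And>\<omega>. \<omega> \<in> space M \<Longrightarrow> 0 \<le> \<tau> \<omega> \<and> \<tau> \<omega> \<le> S"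
  shows "(\<integral>\<omega>. indicator bridge_event \<omega> * X (t + \<tau> \<omega>) \<omega> \<partial>M)
    \<le> prob bridge_event * (a + \<delta> + pinned_gain (1 - t) ((x - a - \<delta>) / (1 - t)))"
proof -
  let ?A = bridge_event
  have A_int: "integrable M (indicator ?A :: 'a \<Rightarrow> real)"
    by (rule integrable_real_indicator) (auto simp: emeasure_eq_measure)
  define v where "v = 1 - t"
  define m where "m = (x - a - \<delta>) / v"
  define w where "w r = 1 / (v - r)" for r
  have v: "0 < v" "S < v" "t < 1" using S by (auto simp: v_def)
  have \<tau>_meas [measurable]: "random_variable borel \<tau>"
    by (rule stopping_time_measurable[OF \<tau>, of S]) (use range S in auto)
  have X_int: "integrable M (\<lambda>\<omega>. X (t + \<tau> \<omega>) \<omega>)"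
    by (rule stopped_integrable[OF t v(3) \<tau>_meas]) (use range S in force)
  note [measurable] = borel_measurable_integrable[OF X_int]
  define L where "L \<omega> = (X (t + \<tau> \<omega>) \<omega> - a) / (v - \<tau> \<omega>) - (x - a) / v" for \<omega>
  have L_meas [measurable]: "random_variable borel L"
    unfolding L_def[abs_def] by measurable
  have path: "AE \<omega> in M. \<omega> \<in> ?A \<longrightarrow> (\<forall>s. 0 \<le> s \<longrightarrow> s < v \<longrightarrow>
      (X (t + s) \<omega> - a) / (v - s) = (x - a) / v + (w s * (B (t + s) \<omega> - B t \<omega>)
        - integral {0..s} (\<lambda>r. (B (t + r) \<omega> - B t \<omega>) * (1 / (v - r)\<^sup>2))))"
    using bridge_path[OF t v(3)] by eventually_elim (simp add: v_def w_def)
  have w_deriv: "(w has_real_derivative 1 / (v - r)\<^sup>2) (at r within {0..s})" if "r \<in> {0..s}" "s < v" for r s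
    unfolding w_def[abs_def] using that
    by (auto intro!: derivative_eq_intros simp: power2_eq_square)
  have w'_cont: "continuous_on {0..s} (\<lambda>r. 1 / (v - r)\<^sup>2)" if "s < v" for s
    using that by (auto intro!: continuous_intros)
  \<comment> \<open>The by-parts formula contains a pathwise integral whose measurability with
    respect to the past of B is not visible. Left sums over a grid of [0, s] use B only up to t + s
    and have the right limit. For s = 0 there is no grid, and X is the constant x.\<close>
  have determined: "\<exists>g\<in>borel_measurable (generated M B {0..t + s}). AE \<omega> in M. \<omega> \<in> ?A \<longrightarrow> X (t + s) \<omega> = g \<omega>"
    if s: "0 \<le> s" "s < S" for s
  proof (cases "s = 0")
    case True
    have "AE \<omega> in M. \<omega> \<in> ?A \<longrightarrow> X (t + s) \<omega> = x"
      using path by eventually_elim (use v in \<open>auto simp: True\<close>)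
    then show ?thesis by (intro bexI[of _ "\<lambda>_. x"]) auto
  next
    case False
    then have "0 < s" using s by simp
    define h where "h n \<omega> = (\<Sum>j<Suc n. w (real j * s / real (Suc n))
        * ((B (t + real (Suc j) * s / real (Suc n)) \<omega> - B t \<omega>) - (B (t + real j * s / real (Suc n)) \<omega> - B t \<omega>)))" for n \<omega>
    have grid: "0 \<le> t + real j * s / real (Suc n) \<and> t + real j * s / real (Suc n) \<le> t + s" if "j \<le> Suc n" for j n
    proof -
      have "real j * s \<le> real (Suc n) * s" using that s by (intro mult_right_mono) auto
      then show ?thesis using s t by (simp add: pos_divide_le_eq mult.commute)
    qed
    have h_meas: "h n \<in> borel_measurable (generated M B {0..t + s})" for n
      unfolding h_def[abs_def] using grid[of _ n] t s
      by (intro borel_measurable_sum borel_measurable_times borel_measurable_diff borel_measurable_const measurable_generated)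
        (auto simp del: of_nat_Suc)
    have X_eq: "AE \<omega> in M. \<omega> \<in> ?A \<longrightarrow> X (t + s) \<omega> = a + (v - s) * ((x - a) / v + lim (\<lambda>n. h n \<omega>))"
      using path brownian_path_continuous[OF t]
    proof eventually_elim
      case (elim \<omega>)
      show ?case
      proof
        assume \<omega>: "\<omega> \<in> ?A"
        let ?\<beta> = "\<lambda>s. B (t + s) \<omega> - B t \<omega>"
        have "(\<lambda>n. \<Sum>j<Suc n. w (real j * s / real (Suc n))
            * (?\<beta> (real (Suc j) * s / real (Suc n)) - ?\<beta> (real j * s / real (Suc n))))
          \<longlonglongrightarrow> w s * ?\<beta> s - w 0 * ?\<beta> 0 - integral {0..s} (\<lambda>r. ?\<beta> r * (1 / (v - r)\<^sup>2))"
        proof (rule tendsto_left_sums_by_parts[OF \<open>0 < s\<close> w_deriv w'_cont])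
          show "continuous_on {0..s} ?\<beta>"
            by (rule continuous_on_subset[OF elim(2)]) auto
        qed (use s v in \<open>simp_all del: of_nat_Suc\<close>)
        then have "(\<lambda>n. h n \<omega>) \<longlonglongrightarrow> w s * ?\<beta> s - integral {0..s} (\<lambda>r. ?\<beta> r * (1 / (v - r)\<^sup>2))"
          unfolding h_def by (simp add: add_divide_distrib)
        then have "lim (\<lambda>n. h n \<omega>) = w s * ?\<beta> s - integral {0..s} (\<lambda>r. ?\<beta> r * (1 / (v - r)\<^sup>2))"
          by (rule limI)
        then have "(X (t + s) \<omega> - a) / (v - s) = (x - a) / v + lim (\<lambda>n. h n \<omega>)"
          using elim(1) \<omega> s v by simp
        then show "X (t + s) \<omega> = a + (v - s) * ((x - a) / v + lim (\<lambda>n. h n \<omega>))"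
          using s v by (simp add: nonzero_divide_eq_eq mult.commute)
      qed
    qed
    have [measurable]: "(\<lambda>\<omega>. lim (\<lambda>n. h n \<omega>)) \<in> borel_measurable (generated M B {0..t + s})"
      by (rule borel_measurable_lim_metric[OF h_meas])
    have "(\<lambda>\<omega>. a + (v - s) * ((x - a) / v + lim (\<lambda>n. h n \<omega>))) \<in> borel_measurable (generated M B {0..t + s})"
      by measurable
    with X_eq show ?thesis by (rule bexI)
  qed
  \<comment> \<open>For w r = 1 / (v - r) the derivative is the square of w, so w is itself an
    antiderivative of the quadratic variation density; hence q = w, the clock of the bridge.\<close>
  have exp_le: "(\<integral>\<^sup>+\<omega>. indicator ?A \<omega> * ennreal (exp (l * L \<omega> - l\<^sup>2 * (w (\<tau> \<omega>) - w 0) / 2)) \<partial>M) \<le> emeasure M ?A" for l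
  proof (rule exp_stopped_integral_le[OF t S(1) bridge_event_vimage determined \<tau> range w_deriv[OF _ v(2)] w'_cont[OF v(2)]])
    show "continuous_on {0..S} w"
      unfolding w_def[abs_def] using v by (auto intro!: continuous_intros)
    show "AE \<omega> in M. \<omega> \<in> ?A \<longrightarrow> L \<omega> = w (\<tau> \<omega>) * (B (t + \<tau> \<omega>) \<omega> - B t \<omega>)
        - integral {0..\<tau> \<omega>} (\<lambda>r. (B (t + r) \<omega> - B t \<omega>) * (1 / (v - r)\<^sup>2))"
      using path AE_space
    proof eventually_elim
      case (elim \<omega>)
      then have "0 \<le> \<tau> \<omega>" "\<tau> \<omega> < v" using range[of \<omega>] v by auto
      with elim(1) show ?case by (simp add: L_def)
    qed
    fix r s assume rs: "0 \<le> r" "r \<le> s" "s \<le> S"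
    then have pos: "0 < v - s" "0 < v - r" using v by auto
    have "(w r)\<^sup>2 * (s - r) = (s - r) / ((v - r) * (v - r))"
      by (simp add: w_def power2_eq_square)
    also have "\<dots> \<le> (s - r) / ((v - r) * (v - s))"
      using pos rs by (intro divide_left_mono mult_left_mono mult_pos_pos) auto
    also have "\<dots> = w s - w r"
      using pos by (simp add: w_def field_simps)
    finally show "(w r)\<^sup>2 * (s - r) \<le> w s - w r" .
  qed simp_all
  define F where "F \<omega> = indicator ?A \<omega> * (X (t + \<tau> \<omega>) \<omega> - a - \<delta>)" for \<omega>
  define E where "E l \<omega> = indicator ?A \<omega> * ennreal (exp (l * L \<omega> - l\<^sup>2 * (w (\<tau> \<omega>) - w 0) / 2))" for l \<omega>
  have F_int: "integrable M F"
    unfolding F_def[abs_def] using X_int by (intro integrable_indicator_mult) auto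
  let ?c = "ennreal (1 - boundary_const\<^sup>2)"
  let ?I = "\<lambda>l. ennreal (exp (l * m - l\<^sup>2 * (1 / v) / 2)) * indicator {0..} l"
  \<comment> \<open>With u the time remaining at \<tau>, the clock satisfies 1 / u = 1 / v + (w
    (\<tau> \<omega>) - w 0). Each exponential of the mixture at \<tau> is therefore the one at the
    lowered start times the supermartingale factor \<open>E l\<close>.\<close>
  have F_le: "ennreal (F \<omega>) \<le> ?c * (\<integral>\<^sup>+l. ?I l * E l \<omega> \<partial>lborel)" if \<omega>: "\<omega> \<in> space M" for \<omega>
  proof (cases "\<omega> \<in> ?A")
    case True
    define u where "u = v - \<tau> \<omega>"
    have u: "0 < u" "u \<le> v" using range[OF \<omega>] v by (auto simp: u_def)
    have "X (t + \<tau> \<omega>) \<omega> - a = u * (L \<omega> + (x - a) / v)"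
      using u by (simp add: L_def u_def[symmetric])
    also have "(x - a) / v = m + \<delta> / v"
      by (simp add: m_def diff_divide_distrib)
    also have "u * (L \<omega> + (m + \<delta> / v)) = u * (L \<omega> + m) + u / v * \<delta>"
      by (simp add: algebra_simps)
    also have "\<dots> \<le> pinned_gain u (L \<omega> + m) + 1 * \<delta>"
      using u v \<delta> by (intro add_mono le_pinned_gain_scaled mult_right_mono) auto
    finally have "F \<omega> \<le> pinned_gain u (L \<omega> + m)" using True by (simp add: F_def)
    then have "ennreal (F \<omega>) \<le> ennreal (pinned_gain u (L \<omega> + m))" by (rule ennreal_leI)
    also have "\<dots> = ?c * (\<integral>\<^sup>+l. ennreal (exp (l * (L \<omega> + m) - l\<^sup>2 * (1 / u) / 2)) * indicator {0..} l \<partial>lborel)"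
      by (rule pinned_gain_eq_nn_integral[OF u(1)])
    also have "(\<lambda>l. ennreal (exp (l * (L \<omega> + m) - l\<^sup>2 * (1 / u) / 2)) * indicator {0..} l) = (\<lambda>l. ?I l * E l \<omega>)"
    proof
      fix l :: real
      have "l * (L \<omega> + m) - l\<^sup>2 * (1 / u) / 2
          = (l * m - l\<^sup>2 * (1 / v) / 2) + (l * L \<omega> - l\<^sup>2 * (w (\<tau> \<omega>) - w 0) / 2)"
        by (simp add: w_def u_def[symmetric] algebra_simps add_divide_distrib diff_divide_distrib)
      then have "ennreal (exp (l * (L \<omega> + m) - l\<^sup>2 * (1 / u) / 2))
          = ennreal (exp (l * m - l\<^sup>2 * (1 / v) / 2)) * ennreal (exp (l * L \<omega> - l\<^sup>2 * (w (\<tau> \<omega>) - w 0) / 2))"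
        by (simp only: exp_add) (rule ennreal_mult, auto)
      then show "ennreal (exp (l * (L \<omega> + m) - l\<^sup>2 * (1 / u) / 2)) * indicator {0..} l = ?I l * E l \<omega>"
        using True by (simp add: E_def mult_ac)
    qed
    finally show ?thesis .
  qed (simp add: F_def)
  interpret pair: pair_sigma_finite M lborel ..
  have w_meas [measurable]: "random_variable borel (\<lambda>\<omega>. w (\<tau> \<omega>))"
    unfolding w_def by measurable
  have "(\<integral>\<^sup>+\<omega>. ennreal (F \<omega>) \<partial>M) \<le> (\<integral>\<^sup>+\<omega>. ?c * (\<integral>\<^sup>+l. ?I l * E l \<omega> \<partial>lborel) \<partial>M)"
    by (rule nn_integral_mono) (rule F_le)
  also have "\<dots> = ?c * (\<integral>\<^sup>+\<omega>. (\<integral>\<^sup>+l. ?I l * E l \<omega> \<partial>lborel) \<partial>M)"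
    unfolding E_def by (rule nn_integral_cmult) measurable
  also have "(\<integral>\<^sup>+\<omega>. (\<integral>\<^sup>+l. ?I l * E l \<omega> \<partial>lborel) \<partial>M) = (\<integral>\<^sup>+l. (\<integral>\<^sup>+\<omega>. ?I l * E l \<omega> \<partial>M) \<partial>lborel)"
    unfolding E_def by (rule pair.Fubini'[symmetric]) measurable
  also have "\<dots> \<le> (\<integral>\<^sup>+l. ?I l * emeasure M ?A \<partial>lborel)"
  proof (rule nn_integral_mono)
    fix l
    have "(\<integral>\<^sup>+\<omega>. ?I l * E l \<omega> \<partial>M) = ?I l * (\<integral>\<^sup>+\<omega>. E l \<omega> \<partial>M)"
      unfolding E_def by (rule nn_integral_cmult) measurable
    also have "\<dots> \<le> ?I l * emeasure M ?A"
      unfolding E_def by (intro mult_left_mono exp_le) simp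
    finally show "(\<integral>\<^sup>+\<omega>. ?I l * E l \<omega> \<partial>M) \<le> ?I l * emeasure M ?A" .
  qed
  also have "\<dots> = (\<integral>\<^sup>+l. ?I l \<partial>lborel) * emeasure M ?A"
    by (rule nn_integral_multc) measurable
  also have "?c * \<dots> = ennreal (pinned_gain v m) * emeasure M ?A"
    by (simp add: pinned_gain_eq_nn_integral[OF v(1)] mult.assoc)
  also have "\<dots> = ennreal (pinned_gain v m * prob ?A)"
    using pinned_gain_nonneg[of v m] v by (simp add: emeasure_eq_measure ennreal_mult)
  finally have nn_F: "(\<integral>\<^sup>+\<omega>. ennreal (F \<omega>) \<partial>M) \<le> ennreal (pinned_gain v m * prob ?A)"
    by (simp add: mult_left_mono)
  \<comment> \<open>\<open>ennreal\<close> cuts off at 0, so the bound just reached concerns the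
    positive part of F, which dominates F.\<close>
  have "ennreal (\<integral>\<omega>. max 0 (F \<omega>) \<partial>M) = (\<integral>\<^sup>+\<omega>. ennreal (F \<omega>) \<partial>M)"
    using F_int by (subst nn_integral_eq_integral[symmetric])
      (auto simp: ennreal_max_0 max.commute intro!: nn_integral_cong)
  with nn_F have "ennreal (\<integral>\<omega>. max 0 (F \<omega>) \<partial>M) \<le> ennreal (pinned_gain v m * prob ?A)"
    by simp
  then have "(\<integral>\<omega>. max 0 (F \<omega>) \<partial>M) \<le> pinned_gain v m * prob ?A"
    using pinned_gain_nonneg[of v m] v by (subst (asm) ennreal_le_iff) auto
  moreover have "(\<integral>\<omega>. F \<omega> \<partial>M) \<le> (\<integral>\<omega>. max 0 (F \<omega>) \<partial>M)"
    using F_int by (intro integral_mono integrable_max) auto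
  ultimately have F_le: "(\<integral>\<omega>. F \<omega> \<partial>M) \<le> pinned_gain v m * prob ?A" by linarith
  have "(\<integral>\<omega>. indicator ?A \<omega> * X (t + \<tau> \<omega>) \<omega> \<partial>M) = (\<integral>\<omega>. F \<omega> + indicator ?A \<omega> * (a + \<delta>) \<partial>M)"
    by (rule Bochner_Integration.integral_cong) (auto simp: F_def algebra_simps)
  also have "\<dots> = (\<integral>\<omega>. F \<omega> \<partial>M) + prob ?A * (a + \<delta>)"
    using F_int A_int by simp
  finally show ?thesis
    using F_le by (simp add: v_def m_def algebra_simps)
qed

text \<open>At the horizon the quotient by the remaining time breaks down, so \<tau> is cut off at
  \<open>S n\<close>. The right-hand side does not depend on n, and the left-hand sides converge by
  path continuity and the integrable majorant.\<close>

lemma bridge_stopped_le: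
  assumes t: "0 \<le> t" "t < 1" and \<delta>: "0 \<le> \<delta>"
    and \<tau>: "stopping_time (observation_filtration M t X) \<tau>"
    and range: "\<And>\<omega>. \<omega> \<in> space M \<Longrightarrow> 0 \<le> \<tau> \<omega> \<and> \<tau> \<omega> \<le> 1 - t"
  shows "(\<integral>\<omega>. indicator bridge_event \<omega> * X (t + \<tau> \<omega>) \<omega> \<partial>M)
    \<le> prob bridge_event * (a + \<delta> + pinned_gain (1 - t) ((x - a - \<delta>) / (1 - t)))"
proof -
  let ?A = bridge_event
  \<comment> \<open>\<open>Suc (Suc n)\<close> makes \<open>S n\<close> positive already for n = 0;
    with \<open>Suc n\<close> the sequence would start at 0.\<close>
  define S where "S n = (1 - t) - (1 - t) / real (Suc (Suc n))" for n
  have S: "0 < S n" "S n < 1 - t" for n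
    using t by (auto simp: S_def pos_divide_less_eq)
  have "S \<longlonglongrightarrow> (1 - t) - 0"
    unfolding S_def[abs_def] by (intro tendsto_diff tendsto_const lim_const_over_n[THEN LIMSEQ_Suc, THEN LIMSEQ_Suc])
  then have S_lim: "S \<longlonglongrightarrow> 1 - t" by simp
  define \<sigma> where "\<sigma> n \<omega> = min (\<tau> \<omega>) (S n)" for n \<omega>
  have \<sigma>: "stopping_time (observation_filtration M t X) (\<sigma> n)" for n
    unfolding \<sigma>_def[abs_def] by (intro stopping_time_min \<tau> stopping_time_const)
  have \<sigma>_range: "0 \<le> \<sigma> n \<omega> \<and> \<sigma> n \<omega> \<le> S n" if "\<omega> \<in> space M" for n \<omega>
    using range[OF that] S[of n] by (auto simp: \<sigma>_def)
  have \<tau>_meas: "random_variable borel \<tau>"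
    by (rule stopping_time_measurable[OF \<tau>, of "1 - t"]) (use range in auto)
  have \<sigma>_meas: "random_variable borel (\<sigma> n)" for n
    unfolding \<sigma>_def[abs_def] using \<tau>_meas by measurable
  have [measurable]: "random_variable borel (\<lambda>\<omega>. X (t + \<tau> \<omega>) \<omega>)"
    by (rule stopped_measurable[OF t(2) \<tau>_meas range])
  have [measurable]: "random_variable borel (\<lambda>\<omega>. X (t + \<sigma> n \<omega>) \<omega>)" for n
    by (rule stopped_measurable[OF t(2) \<sigma>_meas]) (use \<sigma>_range S[of n] in \<open>meson less_imp_le order_trans\<close>)
  obtain D where D: "integrable M D" "AE \<omega> in M. \<forall>s\<in>{0..1 - t}. \<bar>X (t + s) \<omega>\<bar> \<le> D \<omega>"
    by (rule observation_dominated[OF t])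
  have "(\<lambda>n. \<integral>\<omega>. indicator ?A \<omega> * X (t + \<sigma> n \<omega>) \<omega> \<partial>M) \<longlonglongrightarrow> (\<integral>\<omega>. indicator ?A \<omega> * X (t + \<tau> \<omega>) \<omega> \<partial>M)"
  proof (rule integral_dominated_convergence[OF _ _ D(1)])
    show "AE \<omega> in M. (\<lambda>n. indicator ?A \<omega> * X (t + \<sigma> n \<omega>) \<omega>) \<longlonglongrightarrow> indicator ?A \<omega> * X (t + \<tau> \<omega>) \<omega>"
    proof (rule AE_I2)
      fix \<omega> assume \<omega>: "\<omega> \<in> space M"
      have "(\<lambda>n. \<sigma> n \<omega>) \<longlonglongrightarrow> min (\<tau> \<omega>) (1 - t)"
        unfolding \<sigma>_def by (intro tendsto_min tendsto_const S_lim)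
      then have lim: "(\<lambda>n. \<sigma> n \<omega>) \<longlonglongrightarrow> \<tau> \<omega>" using range[OF \<omega>] by simp
      have "\<sigma> n \<omega> \<in> {0..1 - t}" for n
        using \<sigma>_range[OF \<omega>, of n] S[of n] by auto
      then show "(\<lambda>n. indicator ?A \<omega> * X (t + \<sigma> n \<omega>) \<omega>) \<longlonglongrightarrow> indicator ?A \<omega> * X (t + \<tau> \<omega>) \<omega>"
        using range[OF \<omega>]
        by (intro tendsto_mult tendsto_const always_eventually allI
            continuous_on_tendsto_compose[OF observation_path_continuous[OF \<omega>] lim]) auto
    qed
    show "AE \<omega> in M. norm (indicator ?A \<omega> * X (t + \<sigma> n \<omega>) \<omega>) \<le> D \<omega>" for n
      using D(2) AE_space
    proof eventually_elim
      case (elim \<omega>)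
      then have "\<bar>X (t + \<sigma> n \<omega>) \<omega>\<bar> \<le> D \<omega>"
        using \<sigma>_range[of \<omega> n] S[of n] by auto
      then show ?case by (auto simp: indicator_def)
    qed
  qed measurable
  then show ?thesis
    by (rule LIMSEQ_le_const2)
      (use bridge_stopped_le_before[OF t(1) S \<delta> \<sigma> \<sigma>_range] in blast)
qed

end

theorem proposition4p1:
  fixes M :: "'a measure" and a t x p :: real
    and \<theta> :: "'a \<Rightarrow> real" and B X :: "real \<Rightarrow> 'a \<Rightarrow> real"
  assumes "0 \<le> t" "t < 1" and "0 \<le> p" "p \<le> 1"
    and "embedded_problem M a t x p \<theta> B X"
  shows "stopping_value M t X
    \<le> ereal ((1 - belief a t x p) * (x + max a 0) + belief a t x p * pinned_value a t x)"
  unfolding stopping_value_def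
proof (rule SUP_least)
  interpret embedded_problem M a t x p \<theta> B X by fact
  fix \<tau> assume "\<tau> \<in> admissible_times M t X"
  then have \<tau>: "stopping_time (observation_filtration M t X) \<tau>"
    and range: "\<And>\<omega>. \<omega> \<in> space M \<Longrightarrow> 0 \<le> \<tau> \<omega> \<and> \<tau> \<omega> \<le> 1 - t"
    by (auto simp: admissible_times_def)
  have \<tau>_meas: "random_variable borel \<tau>"
    by (rule stopping_time_measurable[OF \<tau>, of "1 - t"]) (use range in auto)
  note X_int = stopped_integrable[OF assms(1,2) \<tau>_meas range]
  \<comment> \<open>The amount by which the start exceeds the boundary, and 0 below it. The lowered
    start x - \<delta> is never above the boundary, which merges the two branches of
    \<open>pinned_value\<close> into one formula.\<close>
  define \<delta> where "\<delta> = max 0 (x - boundary a t)"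
  have v: "0 < 1 - t" using assms by simp
  have pinned: "a + \<delta> + pinned_gain (1 - t) ((x - a - \<delta>) / (1 - t)) = pinned_value a t x"
  proof (cases "x < boundary a t")
    case True
    have "((x - a) / (1 - t))\<^sup>2 * (1 - t) / 2 = (x - a)\<^sup>2 / (2 * (1 - t))"
      using v by (simp add: power2_eq_square)
    moreover have "(x - a) / (1 - t) * sqrt (1 - t) = (x - a) / sqrt (1 - t)"
      using v by (metis real_div_sqrt less_imp_le divide_divide_eq_right times_divide_eq_left mult.commute)
    ultimately have "pinned_gain (1 - t) ((x - a) / (1 - t)) = (1 - boundary_const\<^sup>2)
        * (sqrt (2 * pi * (1 - t)) * exp ((x - a)\<^sup>2 / (2 * (1 - t))) * std_normal_cdf ((x - a) / sqrt (1 - t)))"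
      by (simp only: pinned_gain_def)
    then show ?thesis
      using True by (simp add: \<delta>_def pinned_value_def)
  next
    case False
    have "boundary_const * sqrt (1 - t) / (1 - t) = boundary_const / sqrt (1 - t)"
      using v by (simp add: frac_eq_eq)
    with False pinned_gain_boundary[OF v] show ?thesis
      by (simp add: \<delta>_def boundary_def pinned_value_def)
  qed
  have "(\<integral>\<omega>. X (t + \<tau> \<omega>) \<omega> \<partial>M)
      = (\<integral>\<omega>. indicator drift_event \<omega> * X (t + \<tau> \<omega>) \<omega> + indicator bridge_event \<omega> * X (t + \<tau> \<omega>) \<omega> \<partial>M)"
  proof (rule integral_cong_AE)
    show "AE \<omega> in M. X (t + \<tau> \<omega>) \<omega>
        = indicator drift_event \<omega> * X (t + \<tau> \<omega>) \<omega> + indicator bridge_event \<omega> * X (t + \<tau> \<omega>) \<omega>"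
      using AE_hidden_events
      by eventually_elim (use hidden_events_disjoint in \<open>auto simp: indicator_def\<close>)
  qed (use borel_measurable_integrable[OF X_int] in measurable)
  also have "\<dots> = (\<integral>\<omega>. indicator drift_event \<omega> * X (t + \<tau> \<omega>) \<omega> \<partial>M)
      + (\<integral>\<omega>. indicator bridge_event \<omega> * X (t + \<tau> \<omega>) \<omega> \<partial>M)"
    by (intro Bochner_Integration.integral_add integrable_indicator_mult X_int drift_event_measurable bridge_event_measurable)
  also have "\<dots> \<le> prob drift_event * (x + max a 0) + prob bridge_event * pinned_value a t x"
    using drift_stopped_le[OF assms(1,2) \<tau> range] bridge_stopped_le[OF assms(1,2) _ \<tau> range, of \<delta>]
    by (intro add_mono) (auto simp: pinned[symmetric] \<delta>_def)
  finally show "ereal (\<integral>\<omega>. X (t + \<tau> \<omega>) \<omega> \<partial>M)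
      \<le> ereal ((1 - belief a t x p) * (x + max a 0) + belief a t x p * pinned_value a t x)"
    by (simp add: prob_drift_event prob_bridge_event)
qed

end
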